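(* Let $\alpha=2$ and let $M_\beta$ be an even positive function on $\mathbb{R}^d$ with $\langle M_\beta\rangle=1$, $\langle vM_\beta\rangle=0$ and $\langle v\otimes v\,M_\beta(v)\rangle<+\infty$ (diffusion scaling). Consider the scheme defined for all $k$ and all time indices $0\le n\le N$ such that $N\Delta t=T$ by \[ \hat\rho^{n+1}(k)=\frac{\displaystyle \hat{A}_0(t_{n+1},k)+\sum_{j=1}^n \left( c_j(k)\, \hat\rho^{n+1-j}(k)+b_j(k)\,\hat\rho^{n-j}(k) \right) +b_0(k)\,\hat\rho^n(k)}{1-c_0(k)}, \] with the initial condition $\hat\rho^0(k)=\hat\rho(0,k)$, where \[ \hat A_0(t,k)=\left\langle \mathrm{e}^{-\frac{t}{\varepsilon^2}(1+\mathrm{i}\varepsilon k\cdot v)}\hat f_0(k,v)\right\rangle, \] \[ b_j(k)=\left\langle \left( \frac{\varepsilon^2}{\Delta t}\, \frac{\mathrm{e}^{-\frac{t_j}{\varepsilon^2} (1+\mathrm{i}\varepsilon k\cdot v)}\left( 1-\mathrm{e}^{-\frac{\Delta t}{\varepsilon^2}(1+\mathrm{i}\varepsilon k\cdot v)} \right)}{ (1+\mathrm{i}\varepsilon k\cdot v)^2} -\frac{\mathrm{e}^{-\frac{t_{j+1}}{\varepsilon^2}(1+\mathrm{i}\varepsilon k\cdot v)}}{1+\mathrm{i}\varepsilon k\cdot v}\right)M_\beta(v)\right\rangle, \] \[ c_j(k)=\left\langle \left( \frac{\mathrm{e}^{-\frac{t_{j}}{\varepsilon^2}(1+\mathrm{i}\varepsilon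 k\cdot v)}}{1+\mathrm{i}\varepsilon k\cdot v} - \frac{\varepsilon^2}{\Delta t}\, \frac{\mathrm{e}^{-\frac{t_j}{\varepsilon^2} (1+\mathrm{i}\varepsilon k\cdot v)}\left( 1-\mathrm{e}^{-\frac{\Delta t}{\varepsilon^2}(1+\mathrm{i}\varepsilon k\cdot v)} \right)}{ (1+\mathrm{i}\varepsilon k\cdot v)^2} \right)M_\beta(v)\right\rangle. \] This scheme has the following properties: (i) The scheme is of order $1$ (in time, as an approximation of the kinetic equation $\varepsilon^2\partial_t f+\varepsilon v\cdot\nabla_x f=\rho M_\beta-f$), and the total mass is conserved: for all $n\in\{1,\dots,N\}$, $\hat\rho^n(0)=\hat\rho^0(0)$. (ii) The scheme is AP (Asymptotic Preserving): for a fixed $\Delta t$, when $\varepsilon$ goes to zero the scheme solves the diffusion equation, i.e. it degenerates into \[ \frac{\hat\rho^{n+1}(k)-\hat\rho^n(k)}{\Delta t}=-\left\langle (k\cdot v)^2 M_\beta(v)\right\rangle\hat\rho^{n+1}(k). \]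
   Context: Brackets denote integration over velocity: $\langle h\rangle=\int_{\mathbb{R}^d}h(v)\,\mathrm{d}v$, $d\in\{1,2,3\}$. The kinetic equation, with Knudsen number $\varepsilon>0$, is $\varepsilon^\alpha\partial_t f+\varepsilon v\cdot\nabla_x f=\rho M_\beta-f$ with $\rho(t,x)=\langle f(t,x,v)\rangle$, initial condition $f(0,x,v)=f_0(x,v)$ and periodic boundary conditions in the space variable $x$ in a bounded domain $\Omega\subset\mathbb{R}^d$. Hats denote the Fourier transform in $x$, with Fourier variable $k$; $\hat f_0$ is the Fourier transform of $f_0$ in $x$ and $\hat\rho(0,k)=\langle\hat f_0(k,\cdot)\rangle$. The time discretization is $t_n=n\Delta t$, $n=0,\dots,N$, with $N\Delta t=T$ the final time, and $\hat\rho^n\simeq\hat\rho(t_n)$. In constructing the scheme, the paper assumes that the time derivatives of $\hat\rho$ are bounded uniformly in $\varepsilon$. A scheme is Asymptotic Preserving (AP) if, for arbitrary initial condition $f_0$, it is consistent with the kinetic equation when $\Delta t\to0$ with $\varepsilon$ fixed, and it degenerates into a scheme solving the asymptotic equation when $\varepsilon\to0$ with $\Delta t$ fixed; here the asymptotic equation is the diffusion equation $\partial_t\hat\rho(t,k)=-\langle(k\cdot v)^2M_\beta(v)\rangle\hat\rho(t,k)$. *)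

theory Defs
  imports "HOL-Analysis.Analysis"
begin

section \<open>Setting\<close>

abbreviation bracket :: "(real^'d \<Rightarrow> 'b::{banach, second_countable_topology}) \<Rightarrow> 'b"
  where "bracket h \<equiv> (LINT v|lborel. h v)"

text \<open>Integrability is stated alongside each bracket identity because integrals of
  non-integrable functions are \<open>0\<close> by convention; the last conjunct is the finiteness of the
  matrix of second moments.\<close>

definition diffusive_equilibrium :: "(real^'d \<Rightarrow> real) \<Rightarrow> bool" where
  "diffusive_equilibrium M \<longleftrightarrow>
     (\<forall>v. M (- v) = M v) \<and> (\<forall>v. 0 < M v) \<and>
     integrable lborel M \<and> bracket M = 1 \<and>
     integrable lborel (\<lambda>v. M v *\<^sub>R v) \<and> bracket (\<lambda>v. M v *\<^sub>R v) = 0 \<and>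
     (\<forall>i j. integrable lborel (\<lambda>v. v $ i * v $ j * M v))"

text \<open>The spatial domain with periodic boundary conditions is the box \<open>cbox a b\<close> with opposite
  faces identified. Its Fourier variables form the dual lattice. The Fourier coefficients are not
  divided by the volume of the box, so that the coefficient at \<open>k = 0\<close> is the total mass.\<close>

definition frequencies :: "real^'d \<Rightarrow> real^'d \<Rightarrow> (real^'d) set" where
  "frequencies a b = {k. \<forall>i. \<exists>m::int. k $ i = 2 * pi * of_int m / (b $ i - a $ i)}"

definition fourier :: "real^'d \<Rightarrow> real^'d \<Rightarrow> (real^'d \<Rightarrow> real) \<Rightarrow> real^'d \<Rightarrow> complex" where
  "fourier a b g k =
     (LINT x:cbox a b|lborel. exp (- \<i> * complex_of_real (k \<bullet> x)) * complex_of_real (g x))"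

definition phase_integrable ::
  "real^'d \<Rightarrow> real^'d \<Rightarrow> (real^'d \<Rightarrow> real^'d \<Rightarrow> real) \<Rightarrow> bool" where
  "phase_integrable a b g \<longleftrightarrow>
     set_integrable lborel (cbox a b \<times> UNIV) (\<lambda>(x, v). g x v)"

section \<open>The kinetic equation in the diffusion scaling\<close>

text \<open>Classical solutions on \<open>[0, T]\<close>: for each velocity, \<open>f\<close> is continuously differentiable in
  \<open>(t, x)\<close>, with time derivative \<open>ft\<close> and spatial gradient \<open>fx\<close>; at \<open>t = 0\<close> and \<open>t = T\<close> the
  derivative is one-sided in time.\<close>

definition kinetic_solution ::
  "(real^'d \<Rightarrow> real) \<Rightarrow> real^'d \<Rightarrow> real^'d \<Rightarrow> real \<Rightarrow> real \<Rightarrow>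
   (real^'d \<Rightarrow> real^'d \<Rightarrow> real) \<Rightarrow> (real \<Rightarrow> real^'d \<Rightarrow> real^'d \<Rightarrow> real) \<Rightarrow> bool" where
  "kinetic_solution M a b T \<epsilon> f0 f \<longleftrightarrow>
     (\<forall>t\<in>{0..T}. phase_integrable a b (f t)) \<and>
     (\<forall>t\<in>{0..T}. \<forall>x. integrable lborel (f t x)) \<and>
     (\<forall>t\<in>{0..T}. \<forall>x v i. f t (x + axis i (b $ i - a $ i)) v = f t x v) \<and>
     (\<forall>x\<in>cbox a b. \<forall>v. f 0 x v = f0 x v) \<and>
     (\<exists>ft fx.
        (\<forall>v. continuous_on ({0..T} \<times> UNIV) (\<lambda>(t, x). ft t x v)) \<and>
        (\<forall>v. continuous_on ({0..T} \<times> UNIV) (\<lambda>(t, x). fx t x v)) \<and>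
        (\<forall>t\<in>{0..T}. \<forall>x v.
           ((\<lambda>(s, y). f s y v) has_derivative (\<lambda>(\<tau>, h). \<tau> * ft t x v + h \<bullet> fx t x v))
             (at (t, x) within {0..T} \<times> UNIV)) \<and>
        (\<forall>t\<in>{0..T}. \<forall>x v.
           \<epsilon>\<^sup>2 * ft t x v + \<epsilon> * (v \<bullet> fx t x v) = bracket (f t x) * M v - f t x v))"

definition rho_hat ::
  "real^'d \<Rightarrow> real^'d \<Rightarrow> (real \<Rightarrow> real^'d \<Rightarrow> real^'d \<Rightarrow> real) \<Rightarrow> real^'d \<Rightarrow> real \<Rightarrow> complex" where
  "rho_hat a b f k t = fourier a b (\<lambda>x. bracket (f t x)) k"

definition time_derivatives_bounded :: "real \<Rightarrow> real \<Rightarrow> (real \<Rightarrow> complex) \<Rightarrow> bool" where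
  "time_derivatives_bounded T K r \<longleftrightarrow>
     (\<exists>r' r''. \<forall>t\<in>{0..T}.
        (r has_vector_derivative r' t) (at t within {0..T}) \<and>
        (r' has_vector_derivative r'' t) (at t within {0..T}) \<and>
        norm (r' t) \<le> K \<and> norm (r'' t) \<le> K)"

section \<open>The scheme\<close>

definition f0_hat ::
  "real^'d \<Rightarrow> real^'d \<Rightarrow> (real^'d \<Rightarrow> real^'d \<Rightarrow> real) \<Rightarrow> real^'d \<Rightarrow> real^'d \<Rightarrow> complex" where
  "f0_hat a b f0 k v = fourier a b (\<lambda>x. f0 x v) k"

definition rho0_hat ::
  "real^'d \<Rightarrow> real^'d \<Rightarrow> (real^'d \<Rightarrow> real^'d \<Rightarrow> real) \<Rightarrow> real^'d \<Rightarrow> complex" where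
  "rho0_hat a b f0 k = bracket (\<lambda>v. f0_hat a b f0 k v)"

definition symb :: "real \<Rightarrow> real^'d \<Rightarrow> real^'d \<Rightarrow> complex" where
  "symb \<epsilon> k v = 1 + \<i> * complex_of_real (\<epsilon> * (k \<bullet> v))"

definition decay :: "real \<Rightarrow> real^'d \<Rightarrow> real \<Rightarrow> real^'d \<Rightarrow> complex" where
  "decay \<epsilon> k t v = exp (- complex_of_real (t / \<epsilon>\<^sup>2) * symb \<epsilon> k v)"

definition A0_hat ::
  "real^'d \<Rightarrow> real^'d \<Rightarrow> (real^'d \<Rightarrow> real^'d \<Rightarrow> real) \<Rightarrow> real \<Rightarrow> real \<Rightarrow> real^'d \<Rightarrow> complex" where
  "A0_hat a b f0 \<epsilon> t k = bracket (\<lambda>v. decay \<epsilon> k t v * f0_hat a b f0 k v)"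

definition b_coeff ::
  "(real^'d \<Rightarrow> real) \<Rightarrow> real \<Rightarrow> real \<Rightarrow> real^'d \<Rightarrow> nat \<Rightarrow> complex" where
  "b_coeff M \<epsilon> dt k j = bracket (\<lambda>v.
     (complex_of_real (\<epsilon>\<^sup>2 / dt) * (decay \<epsilon> k (real j * dt) v * (1 - decay \<epsilon> k dt v) / (symb \<epsilon> k v)\<^sup>2)
      - decay \<epsilon> k (real (j + 1) * dt) v / symb \<epsilon> k v) * complex_of_real (M v))"

definition c_coeff ::
  "(real^'d \<Rightarrow> real) \<Rightarrow> real \<Rightarrow> real \<Rightarrow> real^'d \<Rightarrow> nat \<Rightarrow> complex" where
  "c_coeff M \<epsilon> dt k j = bracket (\<lambda>v.
     (decay \<epsilon> k (real j * dt) v / symb \<epsilon> k v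
      - complex_of_real (\<epsilon>\<^sup>2 / dt) * (decay \<epsilon> k (real j * dt) v * (1 - decay \<epsilon> k dt v) / (symb \<epsilon> k v)\<^sup>2))
     * complex_of_real (M v))"

fun scheme ::
  "(real^'d \<Rightarrow> real) \<Rightarrow> real^'d \<Rightarrow> real^'d \<Rightarrow> (real^'d \<Rightarrow> real^'d \<Rightarrow> real) \<Rightarrow>
   real \<Rightarrow> real \<Rightarrow> real^'d \<Rightarrow> nat \<Rightarrow> complex" where
  "scheme M a b f0 \<epsilon> dt k 0 = rho0_hat a b f0 k"
| "scheme M a b f0 \<epsilon> dt k (Suc n) =
     (A0_hat a b f0 \<epsilon> (real (n + 1) * dt) k
      + (\<Sum>j = 1..n. c_coeff M \<epsilon> dt k j * scheme M a b f0 \<epsilon> dt k (n + 1 - j)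
                    + b_coeff M \<epsilon> dt k j * scheme M a b f0 \<epsilon> dt k (n - j))
      + b_coeff M \<epsilon> dt k 0 * scheme M a b f0 \<epsilon> dt k n)
     / (1 - c_coeff M \<epsilon> dt k 0)"

section \<open>Asymptotic preserving schemes\<close>

definition diffusion_coeff :: "(real^'d \<Rightarrow> real) \<Rightarrow> real^'d \<Rightarrow> real" where
  "diffusion_coeff M k = bracket (\<lambda>v. (k \<bullet> v)\<^sup>2 * M v)"

definition diffusion_solution ::
  "(real^'d \<Rightarrow> real) \<Rightarrow> real \<Rightarrow> real^'d \<Rightarrow> complex \<Rightarrow> (real \<Rightarrow> complex) \<Rightarrow> bool" where
  "diffusion_solution M T k u0 u \<longleftrightarrow> u 0 = u0 \<and>
     (\<forall>t\<in>{0..T}. (u has_vector_derivative - complex_of_real (diffusion_coeff M k) * u t)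
                     (at t within {0..T}))"

text \<open>\<open>R N n\<close> is the value computed at time \<open>n * (T / N)\<close> with time step \<open>T / N\<close>. Consistency of a
  scheme is expressed through the values it computes: they converge, uniformly on the time
  grid, to the exact solution \<open>r\<close> as the time step goes to zero.\<close>

definition grid_convergent :: "real \<Rightarrow> (nat \<Rightarrow> nat \<Rightarrow> complex) \<Rightarrow> (real \<Rightarrow> complex) \<Rightarrow> bool" where
  "grid_convergent T R r \<longleftrightarrow>
     (\<forall>e>0. \<forall>\<^sub>F N in sequentially. \<forall>n\<le>N. norm (R N n - r (real n * (T / real N))) < e)"

text \<open>\<open>S f0 \<epsilon> dt k n\<close> is the value computed at time \<open>n * dt\<close>; \<open>L N n\<close> is the limit of the scheme
  for \<open>\<epsilon> \<longlonglongrightarrow> 0\<close> at fixed time step \<open>T / N\<close>.\<close>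

definition asymptotic_preserving ::
  "(real^'d \<Rightarrow> real) \<Rightarrow> real^'d \<Rightarrow> real^'d \<Rightarrow> real \<Rightarrow>
   ((real^'d \<Rightarrow> real^'d \<Rightarrow> real) \<Rightarrow> real \<Rightarrow> real \<Rightarrow> real^'d \<Rightarrow> nat \<Rightarrow> complex) \<Rightarrow> bool" where
  "asymptotic_preserving M a b T S \<longleftrightarrow>
     (\<forall>f0. phase_integrable a b f0 \<longrightarrow> (\<forall>k\<in>frequencies a b.
        (\<forall>\<epsilon>>0. \<forall>f. kinetic_solution M a b T \<epsilon> f0 f \<longrightarrow>
            grid_convergent T (\<lambda>N. S f0 \<epsilon> (T / real N) k) (rho_hat a b f k)) \<and>
        (\<exists>L. (\<forall>N\<ge>1. \<forall>n\<le>N. ((\<lambda>\<epsilon>. S f0 \<epsilon> (T / real N) k n) \<longlongrightarrow> L N n) (at_right 0)) \<and>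
             (\<forall>u. diffusion_solution M T k (rho0_hat a b f0 k) u \<longrightarrow> grid_convergent T L u))))"

end

theory Submission
  imports Defs "HOL-Real_Asymp.Real_Asymp"
begin

text \<open>For fixed \<open>k\<close> the Fourier transform in \<open>x\<close> turns the kinetic equation, at each velocity, into a
linear differential equation with relaxation rate \<open>\<sigma> / \<epsilon>\<^sup>2\<close>, where \<open>\<sigma> = 1 + \<i> \<epsilon> (k \<bullet> v)\<close>. Duhamel's
formula, averaged over \<open>v\<close>, is a Volterra equation for the density: \<open>\<rho> t\<close> is the initial layer
\<open>A0 t\<close> plus the integral over \<open>s \<in> {0..t}\<close> of \<open>exp (- s \<sigma> / \<epsilon>\<^sup>2) / \<epsilon>\<^sup>2\<close>, averaged against \<open>M\<close>,
times \<open>\<rho> (t - s)\<close>. The scheme is this equation with \<open>\<rho>\<close> replaced by its piecewise linear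
interpolant on the time grid: \<open>c\<^sub>j\<close> and \<open>b\<^sub>j\<close> are the exact moments of the kernel on
\<open>{t\<^sub>j..t\<^sub>j\<^sub>+\<^sub>1}\<close> against the two linear functions that interpolate the end values.

\<^bold>\<open>Errors.\<close> Since \<open>Re \<sigma> = 1\<close>, the modulus of the kernel is the same kernel with \<open>\<sigma> = 1\<close>, so all
weights are dominated, whatever \<open>k\<close> and \<open>v\<close>, by nonnegative real majorants. These sum to
\<open>1 - exp (- t / \<epsilon>\<^sup>2)\<close>, and applied to \<open>A t\<close> they fall short of it by exactly
\<open>A \<epsilon>\<^sup>2 (1 - exp (- t / \<epsilon>\<^sup>2))\<close>. Hence a consistency error of that size produces an error of at most
\<open>A t\<close> (\<open>volterra_stability\<close>). The decisive point for an estimate uniform in \<open>\<epsilon>\<close> is that linear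
interpolation is exact at the nodes: at distance \<open>s\<close> in the past its error is at most \<open>K h s\<close>, not
just \<open>K h\<^sup>2\<close>, and the first moment of the kernel is at most \<open>\<epsilon>\<^sup>2 (1 - exp (- t / \<epsilon>\<^sup>2))\<close>. So \<open>A = K h\<close>,
and the scheme has order one with the constant \<open>K T\<close> (\<open>scheme_first_order\<close>). When \<open>\<epsilon>\<close> is
fixed, mere continuity of \<open>\<rho>\<close> in time gives convergence by the same argument
(\<open>scheme_grid_convergent\<close>). At \<open>k = 0\<close> the weights equal their majorants, and the identity for
their sum is conservation of mass.

\<^bold>\<open>Diffusion limit.\<close> As \<open>\<epsilon>\<close> tends to zero at a fixed step, \<open>A0\<close> and all weights with \<open>j \<ge> 1\<close> are
exponentially small, even after division by \<open>\<epsilon>\<^sup>2\<close>. Because the mean velocity vanishes,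
\<open>(1 - c\<^sub>0) / \<epsilon>\<^sup>2\<close> tends to \<open>D + 1 / h\<close> and \<open>b\<^sub>0 / \<epsilon>\<^sup>2\<close> to \<open>1 / h\<close>, where \<open>D\<close> is the diffusion
coefficient; only the implicit Euler step for the diffusion equation remains
(\<open>scheme_diffusion_limit\<close>). That recursion has the explicit solution \<open>\<rho>\<^sub>0 / (1 + D h) ^ n\<close>, which
converges to the exponential.\<close>

section \<open>The weights as moments of the relaxation kernel\<close>

definition damp :: "real \<Rightarrow> complex \<Rightarrow> real \<Rightarrow> complex" where
  "damp \<epsilon> \<sigma> s = exp (- complex_of_real (s / \<epsilon>\<^sup>2) * \<sigma>)"

text \<open>The weights before averaging over velocities, as functions of the complex rate \<open>\<sigma>\<close>. Keeping \<open>\<sigma>\<close>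
abstract makes the comparison with \<open>\<sigma> = 1\<close> an instance of the same formula.\<close>

definition c_weight :: "real \<Rightarrow> real \<Rightarrow> nat \<Rightarrow> complex \<Rightarrow> complex" where
  "c_weight \<epsilon> h j \<sigma> =
     damp \<epsilon> \<sigma> (real j * h) / \<sigma>
     - complex_of_real (\<epsilon>\<^sup>2 / h) * (damp \<epsilon> \<sigma> (real j * h) * (1 - damp \<epsilon> \<sigma> h) / \<sigma>\<^sup>2)"

definition b_weight :: "real \<Rightarrow> real \<Rightarrow> nat \<Rightarrow> complex \<Rightarrow> complex" where
  "b_weight \<epsilon> h j \<sigma> =
     complex_of_real (\<epsilon>\<^sup>2 / h) * (damp \<epsilon> \<sigma> (real j * h) * (1 - damp \<epsilon> \<sigma> h) / \<sigma>\<^sup>2)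
     - damp \<epsilon> \<sigma> (real (j + 1) * h) / \<sigma>"

definition relax :: "real \<Rightarrow> real \<Rightarrow> real" where
  "relax \<epsilon> s = exp (- (s / \<epsilon>\<^sup>2))"

text \<open>The values at \<open>\<sigma> = 1\<close>, as real numbers and in a form that telescopes.\<close>

definition c_majorant :: "real \<Rightarrow> real \<Rightarrow> nat \<Rightarrow> real" where
  "c_majorant \<epsilon> h j =
     relax \<epsilon> (real j * h) - \<epsilon>\<^sup>2 / h * (relax \<epsilon> (real j * h) - relax \<epsilon> (real (j + 1) * h))"

definition b_majorant :: "real \<Rightarrow> real \<Rightarrow> nat \<Rightarrow> real" where
  "b_majorant \<epsilon> h j =
     \<epsilon>\<^sup>2 / h * (relax \<epsilon> (real j * h) - relax \<epsilon> (real (j + 1) * h)) - relax \<epsilon> (real (j + 1) * h)"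

lemma norm_damp: "Re \<sigma> = 1 \<Longrightarrow> norm (damp \<epsilon> \<sigma> s) = relax \<epsilon> s"
  by (simp add: damp_def relax_def)

lemma damp_add: "damp \<epsilon> \<sigma> (s + t) = damp \<epsilon> \<sigma> s * damp \<epsilon> \<sigma> t"
  by (simp add: damp_def add_divide_distrib algebra_simps flip: exp_add)

lemma damp_one: "damp \<epsilon> 1 s = complex_of_real (relax \<epsilon> s)"
  by (simp add: damp_def relax_def exp_of_real[symmetric])

lemma damp_0 [simp]: "damp \<epsilon> \<sigma> 0 = 1"
  by (simp add: damp_def)

lemma relax_0 [simp]: "relax \<epsilon> 0 = 1"
  by (simp add: relax_def)

lemma relax_pos: "0 < relax \<epsilon> s"
  by (simp add: relax_def)

lemma relax_mono: "s \<le> t \<Longrightarrow> relax \<epsilon> t \<le> relax \<epsilon> s"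
  by (simp add: relax_def divide_right_mono)

lemma damp_has_vector_derivative:
  assumes "\<epsilon> \<noteq> 0"
  shows "(damp \<epsilon> \<sigma> has_vector_derivative - (\<sigma> / complex_of_real (\<epsilon>\<^sup>2)) * damp \<epsilon> \<sigma> s) (at s within S)"
proof -
  have "((\<lambda>z. exp (- (z / complex_of_real (\<epsilon>\<^sup>2)) * \<sigma>)) has_field_derivative
         - (\<sigma> / complex_of_real (\<epsilon>\<^sup>2)) * damp \<epsilon> \<sigma> s) (at (complex_of_real s))"
    using assms by (auto intro!: derivative_eq_intros simp: damp_def field_simps power4_eq_xxxx power2_eq_square)
  from has_vector_derivative_real_field[OF this] show ?thesis
    by (simp add: damp_def[abs_def])
qed

text \<open>A primitive of the kernel times the linear function \<open>P + (s - s0) d\<close>. Working with primitives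
replaces every integral in time below by a difference of end values, and every estimate of such an
integral by a comparison of derivatives.\<close>

definition linear_primitive ::
  "real \<Rightarrow> complex \<Rightarrow> real \<Rightarrow> complex \<Rightarrow> complex \<Rightarrow> real \<Rightarrow> complex" where
  "linear_primitive \<epsilon> \<sigma> s0 P d s =
     - damp \<epsilon> \<sigma> s * ((P + complex_of_real (s - s0) * d) / \<sigma> + complex_of_real (\<epsilon>\<^sup>2) * d / \<sigma>\<^sup>2)"

lemma linear_primitive_has_vector_derivative:
  assumes "\<epsilon> \<noteq> 0" "\<sigma> \<noteq> 0"
  shows "(linear_primitive \<epsilon> \<sigma> s0 P d has_vector_derivative
           damp \<epsilon> \<sigma> s / complex_of_real (\<epsilon>\<^sup>2) * (P + complex_of_real (s - s0) * d)) (at s within S)"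
proof -
  have lin: "((\<lambda>s. (P + complex_of_real (s - s0) * d) / \<sigma> + complex_of_real (\<epsilon>\<^sup>2) * d / \<sigma>\<^sup>2)
         has_vector_derivative d / \<sigma>) (at s within S)"
    using assms by (auto intro!: derivative_eq_intros simp: scaleR_conv_of_real field_simps)
  have "((\<lambda>s. - damp \<epsilon> \<sigma> s) has_vector_derivative \<sigma> / complex_of_real (\<epsilon>\<^sup>2) * damp \<epsilon> \<sigma> s) (at s within S)"
    using has_vector_derivative_minus[OF damp_has_vector_derivative[OF assms(1)]] by simp
  note has_vector_derivative_mult[OF this lin]
  then show ?thesis
    unfolding linear_primitive_def[abs_def]
    by (rule has_vector_derivative_eq_rhs)
      (use assms in \<open>simp add: field_simps power2_eq_square\<close>)
qed

text \<open>This identifies the weights: the increment over one time step is the integral of the kernel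
against the linear function with end values \<open>P\<close> and \<open>Q\<close>.\<close>

lemma linear_primitive_step:
  assumes "\<epsilon> \<noteq> 0" "h \<noteq> 0" "\<sigma> \<noteq> 0"
  shows "linear_primitive \<epsilon> \<sigma> (real j * h) P ((Q - P) / complex_of_real h) (real (j + 1) * h)
       - linear_primitive \<epsilon> \<sigma> (real j * h) P ((Q - P) / complex_of_real h) (real j * h)
       = c_weight \<epsilon> h j \<sigma> * P + b_weight \<epsilon> h j \<sigma> * Q"
proof -
  have D: "damp \<epsilon> \<sigma> (real (j + 1) * h) = damp \<epsilon> \<sigma> (real j * h) * damp \<epsilon> \<sigma> h"
    using damp_add[of \<epsilon> \<sigma> "real j * h" h] by (simp add: algebra_simps)
  have e: "real (j + 1) * h - real j * h = h"
    by (simp add: algebra_simps)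
  show ?thesis
    unfolding linear_primitive_def c_weight_def b_weight_def D e
    using assms by (simp add: field_simps power2_eq_square)
qed

lemma c_majorant_eq: "c_weight \<epsilon> h j 1 = complex_of_real (c_majorant \<epsilon> h j)"
  using damp_add[of \<epsilon> 1 "real j * h" h] 
  by (simp add: c_weight_def c_majorant_def damp_one algebra_simps diff_divide_distrib)

lemma b_majorant_eq: "b_weight \<epsilon> h j 1 = complex_of_real (b_majorant \<epsilon> h j)"
  using damp_add[of \<epsilon> 1 "real j * h" h] 
  by (simp add: b_weight_def b_majorant_def damp_one algebra_simps diff_divide_distrib)

text \<open>The analogue of \<open>linear_primitive\<close> for \<open>\<sigma> = 1\<close> and real data; it serves as the dominating function
in the mean value inequality.\<close>

definition real_primitive :: "real \<Rightarrow> real \<Rightarrow> real \<Rightarrow> real \<Rightarrow> real \<Rightarrow> real" where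
  "real_primitive \<epsilon> s0 p d s = - relax \<epsilon> s * (p + (s - s0) * d + \<epsilon>\<^sup>2 * d)"

lemma real_primitive_has_vector_derivative:
  assumes "\<epsilon> \<noteq> 0"
  shows "(real_primitive \<epsilon> s0 p d has_vector_derivative
           relax \<epsilon> s / \<epsilon>\<^sup>2 * (p + (s - s0) * d)) (at s within S)"
proof -
  have "(real_primitive \<epsilon> s0 p d has_real_derivative
           relax \<epsilon> s / \<epsilon>\<^sup>2 * (p + (s - s0) * d)) (at s within S)"
    unfolding real_primitive_def[abs_def] relax_def
    using assms by (auto intro!: derivative_eq_intros simp: field_simps power2_eq_square)
  then show ?thesis
    by (simp add: has_real_derivative_iff_has_vector_derivative)
qed

text \<open>The kernel has modulus \<open>relax \<epsilon> s / \<epsilon>\<^sup>2\<close> because \<open>Re \<sigma> = 1\<close>, so a pointwise bound on the linear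
function passes to its integral against the kernel. The dominating function \<open>p + (s - s0) * d\<close> is
linear as well, which is why its integral is explicit.\<close>

lemma weighted_step_bound:
  assumes "\<epsilon> \<noteq> 0" "0 < h" "Re \<sigma> = 1"
    and dom: "\<And>s. real j * h \<le> s \<Longrightarrow> s \<le> real (j + 1) * h \<Longrightarrow>
       norm (P + complex_of_real (s - real j * h) * ((Q - P) / complex_of_real h)) \<le> p + (s - s0) * d"
  shows "norm (c_weight \<epsilon> h j \<sigma> * P + b_weight \<epsilon> h j \<sigma> * Q)
       \<le> real_primitive \<epsilon> s0 p d (real (j + 1) * h) - real_primitive \<epsilon> s0 p d (real j * h)"
proof -
  have [simp]: "\<sigma> \<noteq> 0" using assms(3) by auto
  let ?F = "linear_primitive \<epsilon> \<sigma> (real j * h) P ((Q - P) / complex_of_real h)"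
  have "norm (?F (real (j + 1) * h) - ?F (real j * h))
      \<le> real_primitive \<epsilon> s0 p d (real (j + 1) * h) - real_primitive \<epsilon> s0 p d (real j * h)"
  proof (rule differentiable_bound_general)
    show "real j * h < real (j + 1) * h" using assms by simp
    show "continuous_on {real j * h..real (j + 1) * h} ?F"
      by (intro continuous_on_vector_derivative)
        (auto intro!: linear_primitive_has_vector_derivative assms)
    show "continuous_on {real j * h..real (j + 1) * h} (real_primitive \<epsilon> s0 p d)"
      by (intro continuous_on_vector_derivative)
        (auto intro!: real_primitive_has_vector_derivative assms)
    show "(?F has_vector_derivative damp \<epsilon> \<sigma> s / complex_of_real (\<epsilon>\<^sup>2) *
        (P + complex_of_real (s - real j * h) * ((Q - P) / complex_of_real h))) (at s)" for s
      by (rule linear_primitive_has_vector_derivative) (simp_all add: assms)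
    show "(real_primitive \<epsilon> s0 p d has_vector_derivative relax \<epsilon> s / \<epsilon>\<^sup>2 * (p + (s - s0) * d)) (at s)" for s
      by (rule real_primitive_has_vector_derivative) (simp add: assms)
    show "norm (damp \<epsilon> \<sigma> s / complex_of_real (\<epsilon>\<^sup>2) *
        (P + complex_of_real (s - real j * h) * ((Q - P) / complex_of_real h)))
        \<le> relax \<epsilon> s / \<epsilon>\<^sup>2 * (p + (s - s0) * d)"
      if "real j * h < s" "s < real (j + 1) * h" for s
      unfolding norm_mult norm_divide norm_damp[OF assms(3)]
      using that by (intro mult_mono dom) (auto simp: norm_power less_imp_le[OF relax_pos])
  qed
  then show ?thesis
    using linear_primitive_step[of \<epsilon> h \<sigma> j P Q] assms by simp
qed

text \<open>The interpolating functions of the two end points are \<open>1 - (s - t\<^sub>j) / h\<close> and \<open>(s - t\<^sub>j) / h\<close>.\<close>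

lemma real_primitive_hats:
  assumes "h \<noteq> 0"
  shows "real_primitive \<epsilon> (real j * h) 1 (- 1 / h) (real (j + 1) * h)
         - real_primitive \<epsilon> (real j * h) 1 (- 1 / h) (real j * h) = c_majorant \<epsilon> h j"
    and "real_primitive \<epsilon> (real j * h) 0 (1 / h) (real (j + 1) * h)
         - real_primitive \<epsilon> (real j * h) 0 (1 / h) (real j * h) = b_majorant \<epsilon> h j"
  using assms by (simp_all add: real_primitive_def c_majorant_def b_majorant_def field_simps)

lemma norm_c_weight_le:
  assumes "\<epsilon> \<noteq> 0" "0 < h" "Re \<sigma> = 1"
  shows "norm (c_weight \<epsilon> h j \<sigma>) \<le> c_majorant \<epsilon> h j"
proof -
  have "norm (c_weight \<epsilon> h j \<sigma> * 1 + b_weight \<epsilon> h j \<sigma> * 0)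
      \<le> real_primitive \<epsilon> (real j * h) 1 (- 1 / h) (real (j + 1) * h)
         - real_primitive \<epsilon> (real j * h) 1 (- 1 / h) (real j * h)"
  proof (rule weighted_step_bound[OF assms])
    fix s assume s: "real j * h \<le> s" "s \<le> real (j + 1) * h"
    have "1 + complex_of_real (s - real j * h) * ((0 - 1) / complex_of_real h)
        = complex_of_real (1 + (s - real j * h) * (- 1 / h))"
      by simp
    moreover have "0 \<le> 1 + (s - real j * h) * (- 1 / h)"
      using s assms(2) by (simp add: field_simps)
    ultimately show "norm (1 + complex_of_real (s - real j * h) * ((0 - 1) / complex_of_real h))
        \<le> 1 + (s - real j * h) * (- 1 / h)"
      by (simp only: norm_of_real abs_of_nonneg)
  qed
  then show ?thesis
    using real_primitive_hats[of h \<epsilon> j] assms by simp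
qed

lemma norm_b_weight_le:
  assumes "\<epsilon> \<noteq> 0" "0 < h" "Re \<sigma> = 1"
  shows "norm (b_weight \<epsilon> h j \<sigma>) \<le> b_majorant \<epsilon> h j"
proof -
  have "norm (c_weight \<epsilon> h j \<sigma> * 0 + b_weight \<epsilon> h j \<sigma> * 1)
      \<le> real_primitive \<epsilon> (real j * h) 0 (1 / h) (real (j + 1) * h)
         - real_primitive \<epsilon> (real j * h) 0 (1 / h) (real j * h)"
  proof (rule weighted_step_bound[OF assms])
    fix s assume s: "real j * h \<le> s" "s \<le> real (j + 1) * h"
    have "0 + complex_of_real (s - real j * h) * ((1 - 0) / complex_of_real h)
        = complex_of_real (0 + (s - real j * h) * (1 / h))"
      by simp
    moreover have "0 \<le> 0 + (s - real j * h) * (1 / h)"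
      using s assms(2) by (simp add: field_simps)
    ultimately show "norm (0 + complex_of_real (s - real j * h) * ((1 - 0) / complex_of_real h))
        \<le> 0 + (s - real j * h) * (1 / h)"
      by (simp only: norm_of_real abs_of_nonneg)
  qed
  then show ?thesis
    using real_primitive_hats[of h \<epsilon> j] assms by simp
qed

lemma majorant_nonneg:
  assumes "\<epsilon> \<noteq> 0" "0 < h"
  shows "0 \<le> c_majorant \<epsilon> h j" "0 \<le> b_majorant \<epsilon> h j"
  using norm_c_weight_le[OF assms, of 1 j] norm_b_weight_le[OF assms, of 1 j]
  by (auto intro: order_trans[OF norm_ge_zero])

lemma c_majorant_0_less_1:
  assumes "\<epsilon> \<noteq> 0" "0 < h"
  shows "c_majorant \<epsilon> h 0 < 1"
proof -
  have "relax \<epsilon> h < 1" using assms by (simp add: relax_def)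
  then show ?thesis using assms by (simp add: c_majorant_def)
qed

lemma sum_majorants:
  "(\<Sum>j\<le>n. c_majorant \<epsilon> h j + b_majorant \<epsilon> h j) = 1 - relax \<epsilon> (real (n + 1) * h)"
  by (induction n) (simp_all add: c_majorant_def b_majorant_def)

lemma sum_real_primitive:
  "(\<Sum>j\<le>n. real_primitive \<epsilon> s0 p d (real (j + 1) * h) - real_primitive \<epsilon> s0 p d (real j * h))
   = real_primitive \<epsilon> s0 p d (real (n + 1) * h) - real_primitive \<epsilon> s0 p d 0"
  using sum_lessThan_telescope[of "\<lambda>j. real_primitive \<epsilon> s0 p d (real j * h)" "Suc n"]
  by (simp add: lessThan_Suc_atMost)

section \<open>Stability of the discrete Volterra equation\<close>

text \<open>Linear interpolation reproduces linear functions, so applying the majorants to \<open>s \<mapsto> t - s\<close> on the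
grid gives its exact integral against the kernel. The deficit
\<open>\<epsilon>\<^sup>2 (1 - relax \<epsilon> t)\<close> is the mean of \<open>min s t\<close> for the exponentially distributed delay \<open>s\<close>, and it
is what pays for consistency errors.\<close>

lemma majorants_of_linear:
  assumes "h \<noteq> 0"
  shows "(\<Sum>j\<le>n. c_majorant \<epsilon> h j * (real (n + 1 - j) * h) + b_majorant \<epsilon> h j * (real (n - j) * h))
       = real (n + 1) * h - \<epsilon>\<^sup>2 * (1 - relax \<epsilon> (real (n + 1) * h))"
proof -
  have "c_majorant \<epsilon> h j * (real (n + 1 - j) * h) + b_majorant \<epsilon> h j * (real (n - j) * h)
      = real_primitive \<epsilon> (real (n + 1) * h) 0 (- 1) (real (j + 1) * h)
        - real_primitive \<epsilon> (real (n + 1) * h) 0 (- 1) (real j * h)" if "j \<le> n" for j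
    using that assms
    by (simp add: c_majorant_def b_majorant_def real_primitive_def of_nat_diff field_simps) 
  then have "(\<Sum>j\<le>n. c_majorant \<epsilon> h j * (real (n + 1 - j) * h) + b_majorant \<epsilon> h j * (real (n - j) * h))
      = real_primitive \<epsilon> (real (n + 1) * h) 0 (- 1) (real (n + 1) * h)
        - real_primitive \<epsilon> (real (n + 1) * h) 0 (- 1) 0"
    by (simp only: sum_real_primitive[symmetric]) (auto intro!: sum.cong)
  then show ?thesis
    by (simp add: real_primitive_def algebra_simps)
qed

text \<open>By \<open>majorants_of_linear\<close> the function \<open>A t\<close> satisfies the recursion with equality. As the
recursion is implicit in \<open>E (n + 1)\<close>, with weight \<open>c_majorant \<epsilon> h 0 < 1\<close>, that term is moved to
the left before the bounds for earlier times are used.\<close>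

lemma volterra_stability:
  fixes E :: "nat \<Rightarrow> real"
  assumes eps: "\<epsilon> \<noteq> 0" and h: "0 < h" and A: "0 \<le> A" and E0: "E 0 = 0"
    and step: "\<And>n. n < N \<Longrightarrow> E (Suc n) \<le>
        (\<Sum>j\<le>n. c_majorant \<epsilon> h j * E (n + 1 - j) + b_majorant \<epsilon> h j * E (n - j))
        + A * \<epsilon>\<^sup>2 * (1 - relax \<epsilon> (real (n + 1) * h))"
    and n: "n \<le> N"
  shows "E n \<le> A * (real n * h)"
  using n
proof (induction n rule: less_induct)
  case (less n)
  show ?case
  proof (cases n)
    case 0
    then show ?thesis using E0 by simp
  next
    case (Suc m)
    note nonneg = majorant_nonneg[OF eps h]
    define G where "G i = A * (real i * h)" for i
    have IH: "E i \<le> G i" if "i \<le> m" for i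
      using less that Suc by (auto simp: G_def)
    have "(\<Sum>j\<le>m. c_majorant \<epsilon> h j * E (m + 1 - j) + b_majorant \<epsilon> h j * E (m - j))
        - c_majorant \<epsilon> h 0 * E (m + 1)
        = (\<Sum>j\<le>m. c_majorant \<epsilon> h j * (if j = 0 then 0 else E (m + 1 - j)) + b_majorant \<epsilon> h j * E (m - j))"
      by (simp add: sum.atMost_shift)
    also have "\<dots> \<le> (\<Sum>j\<le>m. c_majorant \<epsilon> h j * (if j = 0 then 0 else G (m + 1 - j)) + b_majorant \<epsilon> h j * G (m - j))"
      by (intro sum_mono add_mono mult_left_mono nonneg) (auto intro!: IH)
    also have "\<dots> = (\<Sum>j\<le>m. c_majorant \<epsilon> h j * G (m + 1 - j) + b_majorant \<epsilon> h j * G (m - j))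
        - c_majorant \<epsilon> h 0 * G (m + 1)"
      by (simp add: sum.atMost_shift)
    also have "(\<Sum>j\<le>m. c_majorant \<epsilon> h j * G (m + 1 - j) + b_majorant \<epsilon> h j * G (m - j))
        = A * (\<Sum>j\<le>m. c_majorant \<epsilon> h j * (real (m + 1 - j) * h) + b_majorant \<epsilon> h j * (real (m - j) * h))"
      by (simp add: G_def sum_distrib_left algebra_simps)
    also have "\<dots> = G (m + 1) - A * \<epsilon>\<^sup>2 * (1 - relax \<epsilon> (real (m + 1) * h))"
      using h by (subst majorants_of_linear) (simp_all add: G_def algebra_simps)
    finally have "(1 - c_majorant \<epsilon> h 0) * E (m + 1) \<le> (1 - c_majorant \<epsilon> h 0) * G (m + 1)"
      using step[of m] less.prems Suc by (simp add: algebra_simps)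
    then have "E (m + 1) \<le> G (m + 1)"
      using c_majorant_0_less_1[OF eps h] by (simp add: mult_le_cancel_left_pos)
    then show ?thesis by (simp add: Suc G_def)
  qed
qed

section \<open>Duhamel's formula at one velocity\<close>

text \<open>By Duhamel's formula, \<open>\<phi> s = - damp s * g (\<tau> - s)\<close> is a primitive of the kernel times
\<open>m * r (\<tau> - s)\<close>, and its total increment is \<open>g \<tau> - damp \<tau> * g 0\<close>. On each time step the primitive for
the interpolant is subtracted, and the increments of the differences are controlled by the
pointwise interpolation error. That error may have a constant part \<open>p\<close> and a part \<open>s * q\<close> which
vanishes at \<open>s = 0\<close>; the latter only contributes \<open>\<epsilon>\<^sup>2 * q\<close>, as \<open>\<epsilon>\<^sup>2\<close> is the mean delay of the kernel.\<close>

lemma duhamel_interpolation_error: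
  fixes g g' r :: "real \<Rightarrow> complex"
  assumes eps: "\<epsilon> \<noteq> 0" and h: "0 < h" and sig: "Re \<sigma> = 1" and m: "0 \<le> m" and q: "0 \<le> q"
    and T: "real (n + 1) * h \<le> T"
    and g: "\<And>t. t \<in> {0..T} \<Longrightarrow> (g has_vector_derivative g' t) (at t within {0..T})"
    and ode: "\<And>t. t \<in> {0..T} \<Longrightarrow> complex_of_real (\<epsilon>\<^sup>2) * g' t = complex_of_real m * r t - \<sigma> * g t"
    and interp: "\<And>j s. j \<le> n \<Longrightarrow> real j * h \<le> s \<Longrightarrow> s \<le> real (j + 1) * h \<Longrightarrow>
       norm (r (real (n + 1) * h - s) -
         (r (real (n + 1 - j) * h) + complex_of_real (s - real j * h) *
            ((r (real (n - j) * h) - r (real (n + 1 - j) * h)) / complex_of_real h))) \<le> p + s * q"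
  shows "norm (g (real (n + 1) * h) -
      (damp \<epsilon> \<sigma> (real (n + 1) * h) * g 0 + complex_of_real m *
        (\<Sum>j\<le>n. c_weight \<epsilon> h j \<sigma> * r (real (n + 1 - j) * h) + b_weight \<epsilon> h j \<sigma> * r (real (n - j) * h))))
    \<le> m * ((p + \<epsilon>\<^sup>2 * q) * (1 - relax \<epsilon> (real (n + 1) * h)))"
proof -
  have sig0: "\<sigma> \<noteq> 0" using sig by auto
  define \<tau> where "\<tau> = real (n + 1) * h"
  define \<phi> where "\<phi> s = - damp \<epsilon> \<sigma> s * g (\<tau> - s)" for s
  define P where "P j = r (real (n + 1 - j) * h)" for j
  define Q where "Q j = r (real (n - j) * h)" for j
  define L where "L j = linear_primitive \<epsilon> \<sigma> (real j * h) (P j) ((Q j - P j) / complex_of_real h)" for j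
  \<comment> \<open>On step \<open>j\<close>: primitive for the exact density minus primitive for its interpolant.\<close>
  define \<psi> where "\<psi> j s = \<phi> s - complex_of_real m * L j s" for j s
  let ?R = "real_primitive \<epsilon> 0 (m * p) (m * q)"
  have \<tau>: "0 < \<tau>" "\<tau> \<le> T" using h T by (auto simp: \<tau>_def)
  have \<phi>': "(\<phi> has_vector_derivative damp \<epsilon> \<sigma> s / complex_of_real (\<epsilon>\<^sup>2) * (complex_of_real m * r (\<tau> - s)))
      (at s)" if "0 < s" "s < \<tau>" for s
  proof -
    have "(g has_vector_derivative g' (\<tau> - s)) (at (\<tau> - s) within {0..T})"
      using that \<tau> by (intro g) auto
    moreover have "\<tau> - s \<in> interior {0..T}"
      using that \<tau> by auto
    ultimately have "(g has_vector_derivative g' (\<tau> - s)) (at (\<tau> - s))"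
      using at_within_interior by metis
    moreover have "((\<lambda>s. \<tau> - s) has_vector_derivative - 1) (at s)"
      by (auto intro!: derivative_eq_intros)
    ultimately have "((\<lambda>s. g (\<tau> - s)) has_vector_derivative - g' (\<tau> - s)) (at s)"
      using vector_diff_chain_at[of "\<lambda>s. \<tau> - s" "-1" s g "g' (\<tau> - s)"] by (simp add: o_def)
    moreover have "((\<lambda>s. - damp \<epsilon> \<sigma> s) has_vector_derivative \<sigma> / complex_of_real (\<epsilon>\<^sup>2) * damp \<epsilon> \<sigma> s) (at s)"
      using has_vector_derivative_minus[OF damp_has_vector_derivative[OF eps]] by simp
    ultimately have D: "(\<phi> has_vector_derivative - damp \<epsilon> \<sigma> s * - g' (\<tau> - s) +
        \<sigma> / complex_of_real (\<epsilon>\<^sup>2) * damp \<epsilon> \<sigma> s * g (\<tau> - s)) (at s)"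
      unfolding \<phi>_def[abs_def] by (rule has_vector_derivative_mult[rotated])
    have G: "g' (\<tau> - s) = (complex_of_real m * r (\<tau> - s) - \<sigma> * g (\<tau> - s)) / complex_of_real (\<epsilon>\<^sup>2)"
      using ode[of "\<tau> - s"] that \<tau> eps by (simp add: field_simps)
    show ?thesis
      using D unfolding G by (rule has_vector_derivative_eq_rhs) (use eps in \<open>simp add: field_simps\<close>)
  qed
  have contg: "continuous_on {0..T} g"
    by (rule continuous_on_vector_derivative[OF g])
  have cont\<phi>: "continuous_on {0..\<tau>} \<phi>"
    unfolding \<phi>_def[abs_def] damp_def
    by (intro continuous_intros continuous_on_compose2[OF contg]) (use \<tau> eps in auto)
  have step: "norm (\<psi> j (real (j + 1) * h) - \<psi> j (real j * h)) \<le> ?R (real (j + 1) * h) - ?R (real j * h)"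
    if j: "j \<le> n" for j
  proof (rule differentiable_bound_general)
    have j1: "real (j + 1) * h \<le> \<tau>"
      unfolding \<tau>_def using j h by (intro mult_right_mono) auto
    have j0: "0 \<le> real j * h" using h by simp
    show "real j * h < real (j + 1) * h" using h by simp
    show "continuous_on {real j * h..real (j + 1) * h} (\<psi> j)"
      unfolding \<psi>_def[abs_def] L_def
      by (intro continuous_intros continuous_on_subset[OF cont\<phi>]
           continuous_on_vector_derivative[OF linear_primitive_has_vector_derivative])
         (use j1 j0 eps sig0 in auto)
    show "continuous_on {real j * h..real (j + 1) * h} ?R"
      by (rule continuous_on_vector_derivative[OF real_primitive_has_vector_derivative[OF eps]])
    show "(\<psi> j has_vector_derivative
        damp \<epsilon> \<sigma> s / complex_of_real (\<epsilon>\<^sup>2) * (complex_of_real m * r (\<tau> - s))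
        - complex_of_real m * (damp \<epsilon> \<sigma> s / complex_of_real (\<epsilon>\<^sup>2) *
            (P j + complex_of_real (s - real j * h) * ((Q j - P j) / complex_of_real h)))) (at s)"
      if "real j * h < s" "s < real (j + 1) * h" for s
      unfolding \<psi>_def[abs_def] L_def
      by (intro has_vector_derivative_diff \<phi>' has_vector_derivative_mult_right
          linear_primitive_has_vector_derivative) (use that j0 j1 eps sig0 in auto)
    show "(?R has_vector_derivative relax \<epsilon> s / \<epsilon>\<^sup>2 * (m * p + (s - 0) * (m * q))) (at s)" for s
      by (rule real_primitive_has_vector_derivative[OF eps])
    fix s assume s: "real j * h < s" "s < real (j + 1) * h"
    have "norm (damp \<epsilon> \<sigma> s / complex_of_real (\<epsilon>\<^sup>2) * (complex_of_real m * r (\<tau> - s))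
        - complex_of_real m * (damp \<epsilon> \<sigma> s / complex_of_real (\<epsilon>\<^sup>2) *
            (P j + complex_of_real (s - real j * h) * ((Q j - P j) / complex_of_real h))))
        = norm (damp \<epsilon> \<sigma> s / complex_of_real (\<epsilon>\<^sup>2) * complex_of_real m * (r (\<tau> - s) -
            (P j + complex_of_real (s - real j * h) * ((Q j - P j) / complex_of_real h))))"
      by (rule arg_cong[where f=norm]) algebra
    also have "\<dots> = relax \<epsilon> s / \<epsilon>\<^sup>2 * m * norm (r (\<tau> - s) -
            (P j + complex_of_real (s - real j * h) * ((Q j - P j) / complex_of_real h)))"
      using m by (simp only: norm_mult norm_divide norm_damp[OF sig] norm_of_real) simp
    also have "\<dots> \<le> relax \<epsilon> s / \<epsilon>\<^sup>2 * m * (p + s * q)"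
      using interp[OF j, of s] s m
      by (intro mult_left_mono) (auto simp: P_def Q_def \<tau>_def less_imp_le[OF relax_pos])
    finally show "norm (damp \<epsilon> \<sigma> s / complex_of_real (\<epsilon>\<^sup>2) * (complex_of_real m * r (\<tau> - s))
        - complex_of_real m * (damp \<epsilon> \<sigma> s / complex_of_real (\<epsilon>\<^sup>2) *
            (P j + complex_of_real (s - real j * h) * ((Q j - P j) / complex_of_real h))))
        \<le> relax \<epsilon> s / \<epsilon>\<^sup>2 * (m * p + (s - 0) * (m * q))"
      by (simp add: algebra_simps)
  qed
  have "(\<Sum>j\<le>n. \<psi> j (real (j + 1) * h) - \<psi> j (real j * h))
      = (\<Sum>j\<le>n. \<phi> (real (j + 1) * h) - \<phi> (real j * h))
        - complex_of_real m * (\<Sum>j\<le>n. L j (real (j + 1) * h) - L j (real j * h))"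
    unfolding \<psi>_def sum_distrib_left sum_subtractf[symmetric]
    by (intro sum.cong) (simp_all add: algebra_simps)
  also have "(\<Sum>j\<le>n. \<phi> (real (j + 1) * h) - \<phi> (real j * h)) = \<phi> \<tau> - \<phi> 0"
    using sum_lessThan_telescope[of "\<lambda>j. \<phi> (real j * h)" "Suc n"]
    by (simp add: lessThan_Suc_atMost \<tau>_def)
  also have "\<dots> = g \<tau> - damp \<epsilon> \<sigma> \<tau> * g 0"
    by (simp add: \<phi>_def)
  also have "(\<Sum>j\<le>n. L j (real (j + 1) * h) - L j (real j * h))
      = (\<Sum>j\<le>n. c_weight \<epsilon> h j \<sigma> * P j + b_weight \<epsilon> h j \<sigma> * Q j)"
    unfolding L_def using eps h sig0 by (intro sum.cong linear_primitive_step) auto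
  finally have "norm (g \<tau> - damp \<epsilon> \<sigma> \<tau> * g 0 -
       complex_of_real m * (\<Sum>j\<le>n. c_weight \<epsilon> h j \<sigma> * P j + b_weight \<epsilon> h j \<sigma> * Q j))
     = norm (\<Sum>j\<le>n. \<psi> j (real (j + 1) * h) - \<psi> j (real j * h))"
    by simp
  also have "\<dots> \<le> (\<Sum>j\<le>n. ?R (real (j + 1) * h) - ?R (real j * h))"
    by (intro sum_norm_le step) simp
  also have "\<dots> = ?R \<tau> - ?R 0"
    unfolding \<tau>_def by (rule sum_real_primitive)
  also have "\<dots> \<le> m * ((p + \<epsilon>\<^sup>2 * q) * (1 - relax \<epsilon> \<tau>))"
    using m q \<tau> less_imp_le[OF relax_pos[of \<epsilon> \<tau>]] by (simp add: real_primitive_def algebra_simps)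
  finally show ?thesis
    by (simp add: P_def Q_def \<tau>_def algebra_simps)
qed

section \<open>Averages over velocities and the implicit form of the scheme\<close>

lemma Re_symb [simp]: "Re (symb \<epsilon> k v) = 1"
  by (simp add: symb_def)

lemma symb_nonzero [simp]: "symb \<epsilon> k v \<noteq> 0"
  using Re_symb[of \<epsilon> k v] by fastforce

lemma continuous_on_symb [continuous_intros]: "continuous_on S (symb \<epsilon> k)"
  unfolding symb_def[abs_def] by (intro continuous_intros)

lemma decay_eq_damp: "decay \<epsilon> k t v = damp \<epsilon> (symb \<epsilon> k v) t"
  by (simp add: decay_def damp_def)

lemma continuous_on_decay [continuous_intros]: "continuous_on S (decay \<epsilon> k t)"
  unfolding decay_def[abs_def] by (intro continuous_intros)

lemma c_coeff_eq: "c_coeff M \<epsilon> h k j = bracket (\<lambda>v. c_weight \<epsilon> h j (symb \<epsilon> k v) * complex_of_real (M v))"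
  by (simp add: c_coeff_def c_weight_def decay_eq_damp)

lemma b_coeff_eq: "b_coeff M \<epsilon> h k j = bracket (\<lambda>v. b_weight \<epsilon> h j (symb \<epsilon> k v) * complex_of_real (M v))"
  by (simp add: b_coeff_def b_weight_def decay_eq_damp)

lemma measurable_weights:
  "(\<lambda>v. c_weight \<epsilon> h j (symb \<epsilon> k v)) \<in> borel_measurable borel"
  "(\<lambda>v. b_weight \<epsilon> h j (symb \<epsilon> k v)) \<in> borel_measurable borel"
  unfolding c_weight_def b_weight_def decay_eq_damp[symmetric]
  by (intro borel_measurable_continuous_onI continuous_intros; simp)+

lemma integrable_bounded_mult:
  fixes w g :: "'a \<Rightarrow> complex"
  assumes "integrable N g" "w \<in> borel_measurable N" "\<And>v. norm (w v) \<le> B"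
  shows "integrable N (\<lambda>v. w v * g v)"
proof (rule Bochner_Integration.integrable_bound)
  show "integrable N (\<lambda>v. B * norm (g v))"
    using assms(1) by simp
  show "(\<lambda>v. w v * g v) \<in> borel_measurable N"
    using assms by (intro borel_measurable_times) auto
  show "AE v in N. norm (w v * g v) \<le> norm (B * norm (g v))"
    using assms(3) order_trans[OF norm_ge_zero assms(3)]
    by (auto simp: norm_mult abs_mult intro!: mult_right_mono)
qed

lemma diffusive_equilibriumD:
  assumes "diffusive_equilibrium M"
  shows "M v > 0" "M v \<ge> 0" "integrable lborel M" "bracket M = 1"
    "integrable lborel (\<lambda>v. complex_of_real (M v))" "bracket (\<lambda>v. complex_of_real (M v)) = 1"
  using assms by (auto simp: diffusive_equilibrium_def less_imp_le)

lemma bracket_equilibrium_bound: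
  fixes w :: "real^'d \<Rightarrow> complex"
  assumes M: "diffusive_equilibrium M" and w: "w \<in> borel_measurable borel" "\<And>v. norm (w v) \<le> B"
  shows "integrable lborel (\<lambda>v. w v * complex_of_real (M v))"
    and "norm (bracket (\<lambda>v. w v * complex_of_real (M v))) \<le> B"
proof -
  note [simp] = diffusive_equilibriumD[OF M]
  show int: "integrable lborel (\<lambda>v. w v * complex_of_real (M v))"
    by (rule integrable_bounded_mult) (use w in auto)
  have "norm (bracket (\<lambda>v. w v * complex_of_real (M v))) \<le> bracket (\<lambda>v. B * M v)"
    by (rule Bochner_Integration.integral_norm_bound_integral[OF int]) (use w in \<open>auto simp: norm_mult intro!: mult_right_mono\<close>)
  then show "norm (bracket (\<lambda>v. w v * complex_of_real (M v))) \<le> B"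
    by simp
qed

lemma c_coeff_bounds:
  assumes "diffusive_equilibrium M" "\<epsilon> \<noteq> 0" "0 < h"
  shows "norm (c_coeff M \<epsilon> h k j) \<le> c_majorant \<epsilon> h j"
    and "integrable lborel (\<lambda>v. c_weight \<epsilon> h j (symb \<epsilon> k v) * complex_of_real (M v))"
  unfolding c_coeff_eq
  by (intro bracket_equilibrium_bound[where B="c_majorant \<epsilon> h j"] measurable_weights norm_c_weight_le assms; simp)+

lemma b_coeff_bounds:
  assumes "diffusive_equilibrium M" "\<epsilon> \<noteq> 0" "0 < h"
  shows "norm (b_coeff M \<epsilon> h k j) \<le> b_majorant \<epsilon> h j"
    and "integrable lborel (\<lambda>v. b_weight \<epsilon> h j (symb \<epsilon> k v) * complex_of_real (M v))"
  unfolding b_coeff_eq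
  by (intro bracket_equilibrium_bound[where B="b_majorant \<epsilon> h j"] measurable_weights norm_b_weight_le assms; simp)+

lemma c_coeff_0_neq_1:
  assumes "diffusive_equilibrium M" "\<epsilon> \<noteq> 0" "0 < h"
  shows "c_coeff M \<epsilon> h k 0 \<noteq> 1"
  using c_coeff_bounds(1)[OF assms, of k 0] c_majorant_0_less_1[OF assms(2,3)] by auto

text \<open>Multiplying out the denominator \<open>1 - c\<^sub>0\<close> restores the discrete Volterra equation, with the unknown
\<open>\<rho>\<^sup>n\<^sup>+\<^sup>1\<close> on both sides; the error analysis treats all weights alike in this form.\<close>

lemma scheme_implicit:
  assumes "diffusive_equilibrium M" "\<epsilon> \<noteq> 0" "0 < h"
  shows "scheme M a b f0 \<epsilon> h k (Suc n) = A0_hat a b f0 \<epsilon> (real (n + 1) * h) k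
    + (\<Sum>j\<le>n. c_coeff M \<epsilon> h k j * scheme M a b f0 \<epsilon> h k (n + 1 - j)
             + b_coeff M \<epsilon> h k j * scheme M a b f0 \<epsilon> h k (n - j))"
proof -
  have "scheme M a b f0 \<epsilon> h k (Suc n) * (1 - c_coeff M \<epsilon> h k 0)
      = A0_hat a b f0 \<epsilon> (real (n + 1) * h) k
      + (\<Sum>j = 1..n. c_coeff M \<epsilon> h k j * scheme M a b f0 \<epsilon> h k (n + 1 - j)
                    + b_coeff M \<epsilon> h k j * scheme M a b f0 \<epsilon> h k (n - j))
      + b_coeff M \<epsilon> h k 0 * scheme M a b f0 \<epsilon> h k n"
    using c_coeff_0_neq_1[OF assms, of k] by simp
  moreover have "{..n} = insert 0 {1..n}" by auto
  ultimately show ?thesis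
    by (simp add: algebra_simps del: scheme.simps(2))
qed

section \<open>The kinetic equation in Fourier variables\<close>

text \<open>Fubini: along lines parallel to the \<open>i\<close>-th axis the integral is the difference of \<open>G\<close> at opposite
faces, by the fundamental theorem of calculus. Lebesgue measure is the image of a product measure
indexed by \<open>Basis\<close>, from which the factor for this axis is split off.\<close>

lemma integral_periodic_derivative:
  fixes G :: "real^'d \<Rightarrow> complex"
  assumes ab: "a $ i \<le> b $ i"
    and G: "\<And>x. (G has_derivative G' x) (at x)"
    and cont: "continuous_on UNIV (\<lambda>x. G' x (axis i 1))"
    and per: "\<And>x. G (x + axis i (b $ i - a $ i)) = G x"
  shows "(LINT x:cbox a b|lborel. G' x (axis i 1)) = 0"
proof -
  define e :: "real^'d" where "e = axis i 1"
  have e: "e \<in> Basis" "norm e = 1" by (simp_all add: e_def axis_in_Basis_iff)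
  have inner_e: "x \<bullet> e = x $ i" for x :: "real^'d" by (simp add: e_def inner_axis)
  define H where "H x = indicator (cbox a b) x *\<^sub>R G' x e" for x
  define J :: "(real^'d) set" where "J = Basis - {e}"
  have J: "finite J" "e \<notin> J" "insert e J = Basis" using e by (auto simp: J_def)
  define \<Phi> :: "(real^'d \<Rightarrow> real) \<Rightarrow> real^'d" where "\<Phi> f = (\<Sum>u\<in>Basis. f u *\<^sub>R u)" for f
  interpret product_sigma_finite "\<lambda>_ :: real^'d. lborel :: real measure"
    by standard
  have meas: "\<Phi> \<in> measurable (\<Pi>\<^sub>M u\<in>Basis. lborel) borel"
    unfolding \<Phi>_def[abs_def] by measurable
  have intH: "integrable lborel H"
    unfolding H_def e_def
    by (intro borel_integrable_compact continuous_on_subset[OF cont]) auto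
  then have Hm: "H \<in> borel_measurable borel" by auto
  have distr: "lborel = distr (\<Pi>\<^sub>M u\<in>Basis. lborel) borel \<Phi>"
    unfolding \<Phi>_def[abs_def] by (rule lborel_eq)
  \<comment> \<open>A line in direction \<open>e\<close> misses the box or meets it in a segment between opposite faces.\<close>
  have inner0: "(\<integral>y. H (\<Phi> (x(e := y))) \<partial>lborel) = 0" for x
  proof -
    define z where "z = (\<Sum>u\<in>J. x u *\<^sub>R u)"
    have \<Phi>: "\<Phi> (x(e := y)) = z + y *\<^sub>R e" for y
    proof -
      have "\<Phi> (x(e := y)) = y *\<^sub>R e + (\<Sum>u\<in>J. (x(e := y)) u *\<^sub>R u)"
        unfolding \<Phi>_def J(3)[symmetric] using J(1,2) by simp
      also have "(\<Sum>u\<in>J. (x(e := y)) u *\<^sub>R u) = z"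
        unfolding z_def using J(2) by (intro sum.cong) auto
      finally show ?thesis unfolding add.commute[of z] .
    qed
    have ze: "z \<bullet> e = 0"
      unfolding z_def inner_sum_left using e J(2)
      by (intro sum.neutral) (auto simp: J_def inner_Basis)
    have zu: "z \<bullet> u = x u" if "u \<in> J" for u
    proof -
      have "z \<bullet> u = (\<Sum>w\<in>J. if w = u then x w else 0)"
        unfolding z_def inner_sum_left using that
        by (intro sum.cong) (auto simp: J_def inner_Basis)
      then show ?thesis using that J(1) by simp
    qed
    have mem: "z + y *\<^sub>R e \<in> cbox a b \<longleftrightarrow>
        y \<in> {a $ i .. b $ i} \<and> (\<forall>u\<in>J. a \<bullet> u \<le> x u \<and> x u \<le> b \<bullet> u)" for y
    proof -
      have eu: "e \<bullet> u = 0" if "u \<in> J" for u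
        using that e J(2) by (auto simp: J_def inner_Basis)
      have "z + y *\<^sub>R e \<in> cbox a b \<longleftrightarrow>
          (\<forall>u\<in>insert e J. a \<bullet> u \<le> (z + y *\<^sub>R e) \<bullet> u \<and> (z + y *\<^sub>R e) \<bullet> u \<le> b \<bullet> u)"
        unfolding J(3) mem_box ..
      also have "\<dots> \<longleftrightarrow> (a \<bullet> e \<le> y \<and> y \<le> b \<bullet> e) \<and> (\<forall>u\<in>J. a \<bullet> u \<le> x u \<and> x u \<le> b \<bullet> u)"
        using e by (auto simp: inner_add_left ze zu eu dot_square_norm)
      finally show ?thesis by (simp add: inner_e)
    qed
    show ?thesis
    proof (cases "\<forall>u\<in>J. a \<bullet> u \<le> x u \<and> x u \<le> b \<bullet> u")
      case True
      have "(\<integral>y. H (\<Phi> (x(e := y))) \<partial>lborel)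
          = (\<integral>y. indicator {a $ i .. b $ i} y *\<^sub>R G' (z + y *\<^sub>R e) e \<partial>lborel)"
        unfolding \<Phi> H_def using True mem
        by (intro Bochner_Integration.integral_cong refl) (simp add: indicator_def)
      also have "\<dots> = G (z + (b $ i) *\<^sub>R e) - G (z + (a $ i) *\<^sub>R e)"
      proof (rule integral_FTC_atLeastAtMost[OF ab])
        show "continuous_on {a $ i .. b $ i} (\<lambda>y. G' (z + y *\<^sub>R e) e)"
          unfolding e_def by (intro continuous_on_compose2[OF cont] continuous_intros) auto
        show "((\<lambda>y. G (z + y *\<^sub>R e)) has_vector_derivative G' (z + y *\<^sub>R e) e)
            (at y within {a $ i .. b $ i})" for y
        proof -
          have "((\<lambda>y. z + y *\<^sub>R e) has_derivative (\<lambda>\<tau>. \<tau> *\<^sub>R e)) (at y within {a $ i .. b $ i})"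
            by (auto intro!: derivative_eq_intros)
          from has_derivative_compose[OF this G]
          show ?thesis
            using linear_cmul[OF has_derivative_linear[OF G]]
            by (simp add: has_vector_derivative_def)
        qed
      qed
      also have "G (z + (b $ i) *\<^sub>R e) = G (z + (a $ i) *\<^sub>R e)"
      proof -
        have "axis i (b $ i - a $ i) = (b $ i - a $ i) *\<^sub>R e"
          by (simp add: e_def vec_eq_iff axis_def)
        then have "z + (b $ i) *\<^sub>R e = (z + (a $ i) *\<^sub>R e) + axis i (b $ i - a $ i)"
          by (simp add: algebra_simps)
        then show ?thesis by (simp only: per)
      qed
      finally show ?thesis unfolding diff_self .
    next
      case False
      then have "H (\<Phi> (x(e := y))) = 0" for y
        unfolding \<Phi> H_def using mem by (auto simp: indicator_def)
      then show ?thesis by (simp only: Bochner_Integration.integral_zero)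
    qed
  qed
  have int': "integrable (\<Pi>\<^sub>M u\<in>Basis. lborel) (\<lambda>f. H (\<Phi> f))"
    using intH Hm meas by (subst (asm) distr) (simp add: integrable_distr_eq)
  have "(LINT x:cbox a b|lborel. G' x (axis i 1)) = integral\<^sup>L lborel H"
    by (simp add: set_lebesgue_integral_def H_def[abs_def] e_def)
  also have "\<dots> = integral\<^sup>L (\<Pi>\<^sub>M u\<in>Basis. lborel) (\<lambda>f. H (\<Phi> f))"
    by (subst distr, rule integral_distr) (use meas Hm in auto)
  also have "\<dots> = (\<integral>x. (\<integral>y. H (\<Phi> (x(e := y))) \<partial>lborel) \<partial>(\<Pi>\<^sub>M u\<in>J. lborel))"
    using product_integral_insert[OF J(1,2), of "\<lambda>f. H (\<Phi> f)"] int' unfolding J(3) by (simp only:)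
  also have "\<dots> = 0"
    by (simp only: inner0 Bochner_Integration.integral_zero)
  finally show ?thesis .
qed

lemma fourier_integral:
  assumes "continuous_on (cbox a b) g"
  shows "set_integrable lborel (cbox a b) (\<lambda>x. exp (- \<i> * complex_of_real (k \<bullet> x)) * complex_of_real (g x))"
    and "(\<lambda>x. exp (- \<i> * complex_of_real (k \<bullet> x)) * complex_of_real (g x)) integrable_on cbox a b"
    and "fourier a b g k
       = integral (cbox a b) (\<lambda>x. exp (- \<i> * complex_of_real (k \<bullet> x)) * complex_of_real (g x))"
proof -
  show *: "set_integrable lborel (cbox a b) (\<lambda>x. exp (- \<i> * complex_of_real (k \<bullet> x)) * complex_of_real (g x))"
    unfolding set_integrable_def
    by (intro borel_integrable_compact continuous_intros assms) auto
  show "(\<lambda>x. exp (- \<i> * complex_of_real (k \<bullet> x)) * complex_of_real (g x)) integrable_on cbox a b"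
    by (rule set_borel_integral_eq_integral[OF *])
  show "fourier a b g k
       = integral (cbox a b) (\<lambda>x. exp (- \<i> * complex_of_real (k \<bullet> x)) * complex_of_real (g x))"
    unfolding fourier_def by (rule set_borel_integral_eq_integral[OF *])
qed

lemma fourier_integrate_out:
  fixes g :: "real^'d \<Rightarrow> real^'d \<Rightarrow> real"
  assumes "phase_integrable a b g"
  shows "integrable lborel (\<lambda>v. fourier a b (\<lambda>x. g x v) k)"
    and "bracket (\<lambda>v. fourier a b (\<lambda>x. g x v) k) = fourier a b (\<lambda>x. bracket (g x)) k"
proof -
  define F where "F x v = indicator (cbox a b) x *\<^sub>R
      (exp (- \<i> * complex_of_real (k \<bullet> x)) * complex_of_real (g x v))" for x v
  have "integrable lborel (\<lambda>z. indicator (cbox a b \<times> UNIV) z *\<^sub>R (case z of (x, v) \<Rightarrow> g x v))"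
    using assms unfolding phase_integrable_def set_integrable_def .
  then have "integrable lborel (\<lambda>z. exp (- \<i> * complex_of_real (k \<bullet> fst z)) *
      complex_of_real (indicator (cbox a b \<times> UNIV) z *\<^sub>R (case z of (x, v) \<Rightarrow> g x v)))"
    by (intro integrable_bounded_mult[where B=1] integrable_of_real)
       (auto intro!: borel_measurable_continuous_onI continuous_intros)
  also have "(\<lambda>z. exp (- \<i> * complex_of_real (k \<bullet> fst z)) *
      complex_of_real (indicator (cbox a b \<times> UNIV) z *\<^sub>R (case z of (x, v) \<Rightarrow> g x v))) = case_prod F"
    by (auto simp: F_def indicator_def fun_eq_iff)
  finally have F: "integrable (lborel \<Otimes>\<^sub>M lborel) (case_prod F)"
    by (simp add: lborel_prod)
  have 1: "fourier a b (\<lambda>x. g x v) k = (LINT x|lborel. F x v)" for v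
    by (simp add: fourier_def set_lebesgue_integral_def F_def)
  show "integrable lborel (\<lambda>v. fourier a b (\<lambda>x. g x v) k)"
    unfolding 1 by (rule lborel_pair.integrable_snd[OF F])
  have "bracket (\<lambda>v. fourier a b (\<lambda>x. g x v) k) = (LINT x|lborel. bracket (\<lambda>v. F x v))"
    unfolding 1 by (rule lborel_pair.Fubini_integral[OF F])
  also have "\<dots> = fourier a b (\<lambda>x. bracket (g x)) k"
    unfolding fourier_def set_lebesgue_integral_def F_def by simp
  finally show "bracket (\<lambda>v. fourier a b (\<lambda>x. g x v) k) = fourier a b (\<lambda>x. bracket (g x)) k" .
qed

lemma kinetic_solutionE:
  assumes "kinetic_solution M a b T \<epsilon> f0 f"
  obtains ft fx where
    "\<And>v. continuous_on ({0..T} \<times> UNIV) (\<lambda>(t, x). ft t x v)"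
    "\<And>v. continuous_on ({0..T} \<times> UNIV) (\<lambda>(t, x). fx t x v)"
    "\<And>t x v. t \<in> {0..T} \<Longrightarrow> ((\<lambda>(s, y). f s y v) has_derivative
       (\<lambda>(\<tau>, h). \<tau> * ft t x v + h \<bullet> fx t x v)) (at (t, x) within {0..T} \<times> UNIV)"
    "\<And>t x v. t \<in> {0..T} \<Longrightarrow>
       \<epsilon>\<^sup>2 * ft t x v + \<epsilon> * (v \<bullet> fx t x v) = bracket (f t x) * M v - f t x v"
  using assms unfolding kinetic_solution_def
  by (elim conjE exE) (rule_tac ft = ft and fx = fx in that; simp)

text \<open>At \<open>v = 0\<close> the transport term vanishes, and the equation expresses the density through \<open>f\<close> and its
time derivative at \<open>v = 0\<close>, which are continuous.\<close>

lemma kinetic_density_continuous: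
  assumes M: "diffusive_equilibrium M" and f: "kinetic_solution M a b T \<epsilon> f0 f"
  shows "continuous_on ({0..T} \<times> UNIV) (\<lambda>(t, x). bracket (f t x))"
proof -
  obtain ft fx where ft: "\<And>v. continuous_on ({0..T} \<times> UNIV) (\<lambda>(t, x). ft t x v)"
    and deriv: "\<And>t x v. t \<in> {0..T} \<Longrightarrow> ((\<lambda>(s, y). f s y v) has_derivative
            (\<lambda>(\<tau>, h). \<tau> * ft t x v + h \<bullet> fx t x v)) (at (t, x) within {0..T} \<times> UNIV)"
    and eq: "\<And>t x v. t \<in> {0..T} \<Longrightarrow>
           \<epsilon>\<^sup>2 * ft t x v + \<epsilon> * (v \<bullet> fx t x v) = bracket (f t x) * M v - f t x v"
    by (rule kinetic_solutionE[OF f]) blast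
  have "continuous_on ({0..T} \<times> UNIV) (\<lambda>(t, x). f t x 0)"
    unfolding continuous_on_eq_continuous_within
    by (auto intro!: has_derivative_continuous deriv)
  then have "continuous_on ({0..T} \<times> UNIV)
      (\<lambda>z. (\<epsilon>\<^sup>2 * (case z of (t, x) \<Rightarrow> ft t x 0) + (case z of (t, x) \<Rightarrow> f t x 0)) / M 0)"
    using diffusive_equilibriumD(1)[OF M, of 0] by (intro continuous_intros ft) auto
  then show ?thesis
    by (rule continuous_on_cong[THEN iffD1, rotated 2])
      (use eq[of _ _ 0] diffusive_equilibriumD(1)[OF M, of 0] in \<open>auto simp: field_simps\<close>)
qed

lemma continuous_on_pair_slice:
  assumes "continuous_on (A \<times> UNIV) (\<lambda>(t, x). F t x)" "t \<in> A"
  shows "continuous_on S (F t)"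
proof -
  have "continuous_on S (\<lambda>x. case (t, x) of (t, x) \<Rightarrow> F t x)"
    by (rule continuous_on_compose2[OF assms(1)]) (use assms(2) in \<open>auto intro!: continuous_intros\<close>)
  then show ?thesis by simp
qed

lemma rho_hat_continuous:
  assumes M: "diffusive_equilibrium M" and f: "kinetic_solution M a b T \<epsilon> f0 f"
  shows "continuous_on {0..T} (rho_hat a b f k)"
proof -
  note c = kinetic_density_continuous[OF M f]
  have "continuous_on {0..T} (\<lambda>t. integral (cbox a b)
      (\<lambda>x. exp (- \<i> * complex_of_real (k \<bullet> x)) * complex_of_real (bracket (f t x))))"
  proof (rule integral_continuous_on_param)
    have "continuous_on ({0..T} \<times> cbox a b) (\<lambda>z. exp (- \<i> * complex_of_real (k \<bullet> snd z)) *
        complex_of_real (case z of (t, x) \<Rightarrow> bracket (f t x)))"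
      by (intro continuous_intros continuous_on_subset[OF c]) auto
    then show "continuous_on ({0..T} \<times> cbox a b) (\<lambda>(t, x). exp (- \<i> * complex_of_real (k \<bullet> x)) *
        complex_of_real (bracket (f t x)))"
      by (simp add: case_prod_beta')
  qed
  then show ?thesis
    by (rule continuous_on_cong[THEN iffD1, rotated 2])
      (auto simp: rho_hat_def fourier_integral(3)[OF continuous_on_pair_slice[OF c]])
qed

lemma frequencies_exp_periodic:
  assumes "k \<in> frequencies a b" "a $ i < b $ i"
  shows "exp (- \<i> * complex_of_real (k \<bullet> (x + axis i (b $ i - a $ i)))) = exp (- \<i> * complex_of_real (k \<bullet> x))"
proof -
  obtain m :: int where m: "k $ i = 2 * pi * of_int m / (b $ i - a $ i)"
    using assms(1) by (auto simp: frequencies_def)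
  have "k \<bullet> axis i (b $ i - a $ i) = 2 * pi * of_int m"
    using assms(2) by (simp add: inner_axis m)
  then have "exp (- \<i> * complex_of_real (k \<bullet> (x + axis i (b $ i - a $ i))))
      = exp (- \<i> * complex_of_real (k \<bullet> x) + 2 * of_int (- m) * pi * \<i>)"
    by (simp add: inner_add_right algebra_simps)
  also have "\<dots> = exp (- \<i> * complex_of_real (k \<bullet> x))"
    using exp_integer_2pi[of "of_int (- m)", OF Ints_of_int] by (simp only: exp_add mult_1_right)
  finally show ?thesis .
qed

text \<open>Integration by parts against \<open>exp (- \<i> (k \<bullet> x))\<close>, which is periodic because \<open>k\<close> lies in the dual
lattice.\<close>

lemma fourier_directional_derivative:
  fixes g :: "real^'d \<Rightarrow> real" and dg :: "real^'d \<Rightarrow> real^'d"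
  assumes box: "\<And>i. a $ i < b $ i" and k: "k \<in> frequencies a b"
    and per: "\<And>x i. g (x + axis i (b $ i - a $ i)) = g x"
    and g: "\<And>x. (g has_derivative (\<lambda>h. h \<bullet> dg x)) (at x)"
    and dg: "continuous_on UNIV dg"
  shows "fourier a b (\<lambda>x. v \<bullet> dg x) k = \<i> * complex_of_real (k \<bullet> v) * fourier a b g k"
proof -
  define e where "e x = exp (- \<i> * complex_of_real (k \<bullet> x))" for x
  define G' where "G' x h = e x * complex_of_real (h \<bullet> dg x) - \<i> * complex_of_real (k \<bullet> h) * (e x * complex_of_real (g x))" for x h
  have contg: "continuous_on S g" for S
    using g by (meson continuous_at_imp_continuous_on has_derivative_continuous)
  have conte: "continuous_on S e" for S
    unfolding e_def[abs_def] by (intro continuous_intros)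
  have contdg: "continuous_on S (\<lambda>x. h \<bullet> dg x)" for S h
    by (intro continuous_intros continuous_on_subset[OF dg]) auto
  have contG': "continuous_on S (\<lambda>x. G' x h)" for S h
    unfolding G'_def by (intro continuous_intros conte contdg contg)
  have G: "((\<lambda>x. e x * complex_of_real (g x)) has_derivative G' x) (at x)" for x
  proof -
    have "((\<lambda>x. - \<i> * complex_of_real (k \<bullet> x)) has_derivative (\<lambda>h. - \<i> * complex_of_real (k \<bullet> h))) (at x)"
      by (intro has_derivative_mult_right bounded_linear_imp_has_derivative
          bounded_linear_compose[OF bounded_linear_of_real bounded_linear_inner_right])
    from has_derivative_compose[OF this DERIV_exp[unfolded has_field_derivative_def]]
    have "(e has_derivative (\<lambda>h. e x * (- \<i> * complex_of_real (k \<bullet> h)))) (at x)"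
      by (simp add: e_def[abs_def])
    moreover have "((\<lambda>x. complex_of_real (g x)) has_derivative (\<lambda>h. complex_of_real (h \<bullet> dg x))) (at x)"
      by (rule bounded_linear.has_derivative[OF bounded_linear_of_real, OF g])
    ultimately have "((\<lambda>x. e x * complex_of_real (g x)) has_derivative
        (\<lambda>h. e x * complex_of_real (h \<bullet> dg x) + e x * (- \<i> * complex_of_real (k \<bullet> h)) * complex_of_real (g x))) (at x)"
      by (rule has_derivative_mult)
    then show ?thesis
      by (rule has_derivative_eq_rhs) (simp add: G'_def fun_eq_iff)
  qed
  have axis0: "(LINT x:cbox a b|lborel. G' x (axis i 1)) = 0" for i
  proof (rule integral_periodic_derivative[OF _ G contG'])
    show "a $ i \<le> b $ i" using box[of i] by simp
    show "e (x + axis i (b $ i - a $ i)) * complex_of_real (g (x + axis i (b $ i - a $ i)))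
        = e x * complex_of_real (g x)" for x
      unfolding e_def per frequencies_exp_periodic[OF k box] ..
  qed
  have G'v: "G' x v = (\<Sum>i\<in>UNIV. complex_of_real (v $ i) * G' x (axis i 1))" for x
  proof -
    have "G' x v = G' x (\<Sum>i\<in>UNIV. v $ i *\<^sub>R axis i 1)"
      by (rule arg_cong) (use basis_expansion[of v] in \<open>simp add: scalar_mult_eq_scaleR\<close>)
    also have "\<dots> = (\<Sum>i\<in>UNIV. v $ i *\<^sub>R G' x (axis i 1))"
      using has_derivative_linear[OF G[of x]] by (simp add: linear_sum linear_scale)
    finally show ?thesis by (simp add: scaleR_conv_of_real)
  qed
  have int: "set_integrable lborel (cbox a b) (\<lambda>x. G' x h)" for h
    unfolding set_integrable_def by (intro borel_integrable_compact contG') auto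
  have "(LINT x:cbox a b|lborel. G' x v) = (\<Sum>i\<in>UNIV. LINT x:cbox a b|lborel. complex_of_real (v $ i) * G' x (axis i 1))"
    unfolding G'v set_lebesgue_integral_def scaleR_sum_right
    by (rule Bochner_Integration.integral_sum)
      (use set_integrable_mult_right[OF int] in \<open>simp add: set_integrable_def\<close>)
  also have "\<dots> = 0"
    by (simp add: axis0)
  finally have 0: "(LINT x:cbox a b|lborel. G' x v) = 0" .
  have "(LINT x:cbox a b|lborel. G' x v)
      = fourier a b (\<lambda>x. v \<bullet> dg x) k - \<i> * complex_of_real (k \<bullet> v) * fourier a b g k"
    unfolding G'_def fourier_def e_def
    using fourier_integral(1)[OF contdg[of _ v], of a b k] fourier_integral(1)[OF contg, of a b k]
    by (simp add: set_integral_diff)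
  with 0 show ?thesis by simp
qed

lemma kinetic_fourier_ode:
  fixes M :: "real^'d \<Rightarrow> real"
  assumes M: "diffusive_equilibrium M" and box: "\<And>i. a $ i < b $ i"
    and f: "kinetic_solution M a b T \<epsilon> f0 f" and k: "k \<in> frequencies a b"
  obtains g' where
    "\<And>t. t \<in> {0..T} \<Longrightarrow>
       ((\<lambda>t. fourier a b (\<lambda>x. f t x v) k) has_vector_derivative g' t) (at t within {0..T})"
    "\<And>t. t \<in> {0..T} \<Longrightarrow> complex_of_real (\<epsilon>\<^sup>2) * g' t
       = complex_of_real (M v) * rho_hat a b f k t - symb \<epsilon> k v * fourier a b (\<lambda>x. f t x v) k"
proof -
  obtain ft fx where ft: "\<And>v. continuous_on ({0..T} \<times> UNIV) (\<lambda>(t, x). ft t x v)"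
    and fx: "\<And>v. continuous_on ({0..T} \<times> UNIV) (\<lambda>(t, x). fx t x v)"
    and deriv: "\<And>t x v. t \<in> {0..T} \<Longrightarrow> ((\<lambda>(s, y). f s y v) has_derivative
            (\<lambda>(\<tau>, h). \<tau> * ft t x v + h \<bullet> fx t x v)) (at (t, x) within {0..T} \<times> UNIV)"
    and eq: "\<And>t x v. t \<in> {0..T} \<Longrightarrow>
           \<epsilon>\<^sup>2 * ft t x v + \<epsilon> * (v \<bullet> fx t x v) = bracket (f t x) * M v - f t x v"
    by (rule kinetic_solutionE[OF f]) blast
  have per: "f t (x + axis i (b $ i - a $ i)) v = f t x v" if "t \<in> {0..T}" for t x i
    using f that by (auto simp: kinetic_solution_def)
  have contf: "continuous_on ({0..T} \<times> UNIV) (\<lambda>(t, x). f t x v)"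
    unfolding continuous_on_eq_continuous_within
    by (auto intro!: has_derivative_continuous deriv)
  note contr = kinetic_density_continuous[OF M f]
  have ft_slice: "continuous_on S (\<lambda>x. ft t x v)" if "t \<in> {0..T}" for t S
    using continuous_on_pair_slice[OF ft that] .
  have fx_slice: "continuous_on S (\<lambda>x. fx t x v)" if "t \<in> {0..T}" for t S
    using continuous_on_pair_slice[OF fx that] .
  have f_slice: "continuous_on S (\<lambda>x. f t x v)" if "t \<in> {0..T}" for t S
    using continuous_on_pair_slice[OF contf that] .
  have r_slice: "continuous_on S (\<lambda>x. bracket (f t x))" if "t \<in> {0..T}" for t S
    using continuous_on_pair_slice[OF contr that] .
  have dt: "((\<lambda>t. f t x v) has_vector_derivative ft t x v) (at t within {0..T})" if "t \<in> {0..T}" for t x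
  proof -
    have 1: "((\<lambda>s. (s, x)) has_derivative (\<lambda>\<tau>. (\<tau>, 0))) (at t within {0..T})"
      by (auto intro!: derivative_eq_intros)
    have "((\<lambda>(s, y). f s y v) has_derivative (\<lambda>(\<tau>, h). \<tau> * ft t x v + h \<bullet> fx t x v))
        (at (t, x) within (\<lambda>s. (s, x)) ` {0..T})"
      by (rule has_derivative_subset[OF deriv[OF that]]) auto
    from has_derivative_in_compose[OF 1 this] show ?thesis
      by (simp add: has_vector_derivative_def)
  qed
  have dx: "((\<lambda>x. f t x v) has_derivative (\<lambda>h. h \<bullet> fx t x v)) (at x)" if "t \<in> {0..T}" for t x
  proof -
    have 1: "((\<lambda>y. (t, y)) has_derivative (\<lambda>h. (0, h))) (at x)"
      by (auto intro!: derivative_eq_intros)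
    have "((\<lambda>(s, y). f s y v) has_derivative (\<lambda>(\<tau>, h). \<tau> * ft t x v + h \<bullet> fx t x v))
        (at (t, x) within range (\<lambda>y. (t, y)))"
      by (rule has_derivative_subset[OF deriv[OF that]]) (use that in auto)
    from has_derivative_in_compose[OF 1 this] show ?thesis by simp
  qed
  define g' where "g' t = fourier a b (\<lambda>x. ft t x v) k" for t
  show thesis
  proof
    fix t assume t: "t \<in> {0..T}"
    have "((\<lambda>t. integral (cbox a b) (\<lambda>x. exp (- \<i> * complex_of_real (k \<bullet> x)) * complex_of_real (f t x v)))
        has_vector_derivative
        integral (cbox a b) (\<lambda>x. exp (- \<i> * complex_of_real (k \<bullet> x)) * complex_of_real (ft t x v)))
        (at t within {0..T})"
    proof (rule leibniz_rule_vector_derivative[OF _ _ _ t])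
      show "((\<lambda>t. exp (- \<i> * complex_of_real (k \<bullet> x)) * complex_of_real (f t x v)) has_vector_derivative
          exp (- \<i> * complex_of_real (k \<bullet> x)) * complex_of_real (ft s x v)) (at s within {0..T})"
        if "s \<in> {0..T}" for s x
        by (intro has_vector_derivative_mult_right has_vector_derivative_of_real
            dt[unfolded has_real_derivative_iff_has_vector_derivative[symmetric]] that)
      show "(\<lambda>x. exp (- \<i> * complex_of_real (k \<bullet> x)) * complex_of_real (f s x v)) integrable_on cbox a b"
        if "s \<in> {0..T}" for s
        by (rule fourier_integral(2)[OF f_slice[OF that]])
      have "continuous_on ({0..T} \<times> cbox a b) (\<lambda>z. exp (- \<i> * complex_of_real (k \<bullet> snd z)) *
          complex_of_real (case z of (t, x) \<Rightarrow> ft t x v))"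
        by (intro continuous_intros continuous_on_subset[OF ft]) auto
      then show "continuous_on ({0..T} \<times> cbox a b)
          (\<lambda>(t, x). exp (- \<i> * complex_of_real (k \<bullet> x)) * complex_of_real (ft t x v))"
        by (simp add: case_prod_beta')
    qed simp
    then show "((\<lambda>t. fourier a b (\<lambda>x. f t x v) k) has_vector_derivative g' t) (at t within {0..T})"
      unfolding g'_def fourier_integral(3)[OF ft_slice[OF t]]
      by (rule has_vector_derivative_transform[OF t, rotated])
        (simp add: fourier_integral(3)[OF f_slice])
    have "complex_of_real (\<epsilon>\<^sup>2) * g' t + complex_of_real \<epsilon> * fourier a b (\<lambda>x. v \<bullet> fx t x v) k
        = fourier a b (\<lambda>x. \<epsilon>\<^sup>2 * ft t x v + \<epsilon> * (v \<bullet> fx t x v)) k"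
    proof -
      have c: "continuous_on (cbox a b) (\<lambda>x. v \<bullet> fx t x v)"
        by (intro continuous_intros fx_slice t)
      show ?thesis
        using fourier_integral(1)[OF ft_slice[OF t], of a b k] fourier_integral(1)[OF c, of k]
        unfolding g'_def fourier_def
        by (simp add: set_integral_add distrib_left mult.left_commute[of "exp _"])
    qed
    also have "\<dots> = fourier a b (\<lambda>x. bracket (f t x) * M v - f t x v) k"
      by (simp add: eq[OF t])
    also have "\<dots> = complex_of_real (M v) * rho_hat a b f k t - fourier a b (\<lambda>x. f t x v) k"
      using fourier_integral(1)[OF r_slice[OF t], of a b k] fourier_integral(1)[OF f_slice[OF t], of a b k]
      unfolding rho_hat_def fourier_def
      by (simp add: set_integral_diff right_diff_distrib mult.commute[of _ "complex_of_real (M v)"] mult.left_commute[of "exp _"])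
    also have "fourier a b (\<lambda>x. v \<bullet> fx t x v) k
        = \<i> * complex_of_real (k \<bullet> v) * fourier a b (\<lambda>x. f t x v) k"
      by (rule fourier_directional_derivative[OF box k per[OF t] dx[OF t] fx_slice[OF t]])
    finally show "complex_of_real (\<epsilon>\<^sup>2) * g' t
       = complex_of_real (M v) * rho_hat a b f k t - symb \<epsilon> k v * fourier a b (\<lambda>x. f t x v) k"
      by (simp add: symb_def algebra_simps)
  qed
qed

section \<open>Error estimates\<close>

lemma kinetic_initial:
  assumes "kinetic_solution M a b T \<epsilon> f0 f" "0 \<le> T"
  shows "f0_hat a b f0 k v = fourier a b (\<lambda>x. f 0 x v) k"
    and "rho0_hat a b f0 k = rho_hat a b f k 0"
proof -
  have eq: "f 0 x v = f0 x v" if "x \<in> cbox a b" for x v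
    using assms(1) that by (auto simp: kinetic_solution_def)
  show *: "f0_hat a b f0 k v = fourier a b (\<lambda>x. f 0 x v) k" for v
    unfolding f0_hat_def fourier_def
    by (rule set_lebesgue_integral_cong) (auto simp: eq)
  have "phase_integrable a b (f 0)"
    using assms by (auto simp: kinetic_solution_def)
  then show "rho0_hat a b f0 k = rho_hat a b f k 0"
    unfolding rho0_hat_def * rho_hat_def by (rule fourier_integrate_out(2))
qed

lemma norm_decay: "norm (decay \<epsilon> k t v) = relax \<epsilon> t"
  by (simp add: decay_eq_damp norm_damp)

lemma measurable_decay: "decay \<epsilon> k t \<in> borel_measurable borel"
  by (intro borel_measurable_continuous_onI continuous_intros)

text \<open>The estimate of \<open>duhamel_interpolation_error\<close> is uniform in \<open>v\<close> up to the factor \<open>M v\<close>, whose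
integral is one. The only exchange of integrals is between \<open>x\<close> and \<open>v\<close>.\<close>

lemma scheme_consistency:
  assumes M: "diffusive_equilibrium M" and box: "\<And>i. a $ i < b $ i"
    and f: "kinetic_solution M a b T \<epsilon> f0 f" and k: "k \<in> frequencies a b"
    and eps: "\<epsilon> \<noteq> 0" and h: "0 < h" and q: "0 \<le> q" and T: "real (n + 1) * h \<le> T"
    and interp: "\<And>j s. j \<le> n \<Longrightarrow> real j * h \<le> s \<Longrightarrow> s \<le> real (j + 1) * h \<Longrightarrow>
       norm (rho_hat a b f k (real (n + 1) * h - s) -
         (rho_hat a b f k (real (n + 1 - j) * h) + complex_of_real (s - real j * h) *
            ((rho_hat a b f k (real (n - j) * h) - rho_hat a b f k (real (n + 1 - j) * h))
              / complex_of_real h))) \<le> p + s * q"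
  shows "norm (rho_hat a b f k (real (n + 1) * h) - (A0_hat a b f0 \<epsilon> (real (n + 1) * h) k +
      (\<Sum>j\<le>n. c_coeff M \<epsilon> h k j * rho_hat a b f k (real (n + 1 - j) * h)
               + b_coeff M \<epsilon> h k j * rho_hat a b f k (real (n - j) * h))))
    \<le> (p + \<epsilon>\<^sup>2 * q) * (1 - relax \<epsilon> (real (n + 1) * h))"
proof -
  define \<tau> where "\<tau> = real (n + 1) * h"
  define r where "r = rho_hat a b f k"
  define B where "B = (p + \<epsilon>\<^sup>2 * q) * (1 - relax \<epsilon> \<tau>)"
  define g where "g v t = fourier a b (\<lambda>x. f t x v) k" for v t
  define cw where "cw j v = c_weight \<epsilon> h j (symb \<epsilon> k v) * complex_of_real (M v)" for j v
  define bw where "bw j v = b_weight \<epsilon> h j (symb \<epsilon> k v) * complex_of_real (M v)" for j v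
  have T0: "0 \<le> T" using h T by (meson less_imp_le mult_nonneg_nonneg of_nat_0_le_iff order_trans)
  have \<tau>: "\<tau> \<in> {0..T}" using h T by (auto simp: \<tau>_def)
  have ph: "phase_integrable a b (f t)" if "t \<in> {0..T}" for t
    using f that by (auto simp: kinetic_solution_def)
  have pointwise: "norm (g v \<tau> - (decay \<epsilon> k \<tau> v * f0_hat a b f0 k v +
      (\<Sum>j\<le>n. cw j v * r (real (n + 1 - j) * h) + bw j v * r (real (n - j) * h)))) \<le> B * M v" for v
  proof -
    obtain g' where g': "\<And>t. t \<in> {0..T} \<Longrightarrow> (g v has_vector_derivative g' t) (at t within {0..T})"
      "\<And>t. t \<in> {0..T} \<Longrightarrow> complex_of_real (\<epsilon>\<^sup>2) * g' t = complex_of_real (M v) * r t - symb \<epsilon> k v * g v t"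
      using kinetic_fourier_ode[OF M box f k, where v=v] unfolding g_def r_def by blast
    have eq: "decay \<epsilon> k \<tau> v * f0_hat a b f0 k v +
      (\<Sum>j\<le>n. cw j v * r (real (n + 1 - j) * h) + bw j v * r (real (n - j) * h))
      = damp \<epsilon> (symb \<epsilon> k v) \<tau> * g v 0 + complex_of_real (M v) *
        (\<Sum>j\<le>n. c_weight \<epsilon> h j (symb \<epsilon> k v) * r (real (n + 1 - j) * h)
               + b_weight \<epsilon> h j (symb \<epsilon> k v) * r (real (n - j) * h))"
      unfolding decay_eq_damp kinetic_initial(1)[OF f T0] g_def cw_def bw_def sum_distrib_left
      by (intro arg_cong2[where f="(+)"] sum.cong) (simp_all add: algebra_simps)
    show ?thesis
      using duhamel_interpolation_error[OF eps h Re_symb _ q T g' interp[folded r_def]]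
        diffusive_equilibriumD(2)[OF M, of v]
      unfolding eq by (simp add: \<tau>_def B_def mult.commute mult.left_commute)
  qed
  have ig: "integrable lborel (\<lambda>v. g v \<tau>)" "bracket (\<lambda>v. g v \<tau>) = r \<tau>"
    unfolding g_def r_def rho_hat_def by (rule fourier_integrate_out[OF ph[OF \<tau>]])+
  have iA: "integrable lborel (\<lambda>v. decay \<epsilon> k \<tau> v * f0_hat a b f0 k v)"
    unfolding kinetic_initial(1)[OF f T0]
    by (rule integrable_bounded_mult[OF fourier_integrate_out(1)[OF ph] _ eq_refl[OF norm_decay]])
      (use T0 measurable_decay in auto)
  have ic: "integrable lborel (cw j)" "bracket (cw j) = c_coeff M \<epsilon> h k j" for j
    unfolding cw_def[abs_def] c_coeff_eq using c_coeff_bounds(2)[OF M eps h] by auto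
  have ib: "integrable lborel (bw j)" "bracket (bw j) = b_coeff M \<epsilon> h k j" for j
    unfolding bw_def[abs_def] b_coeff_eq using b_coeff_bounds(2)[OF M eps h] by auto
  have isum: "integrable lborel (\<lambda>v. \<Sum>j\<le>n. cw j v * r (real (n + 1 - j) * h) + bw j v * r (real (n - j) * h))"
    by (intro Bochner_Integration.integrable_sum Bochner_Integration.integrable_add
        integrable_mult_left ic ib)
  let ?D = "\<lambda>v. g v \<tau> - (decay \<epsilon> k \<tau> v * f0_hat a b f0 k v +
      (\<Sum>j\<le>n. cw j v * r (real (n + 1 - j) * h) + bw j v * r (real (n - j) * h)))"
  have iD: "integrable lborel ?D"
    by (intro Bochner_Integration.integrable_diff Bochner_Integration.integrable_add ig iA isum)
  have "bracket ?D = r \<tau> - (A0_hat a b f0 \<epsilon> \<tau> k +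
      (\<Sum>j\<le>n. c_coeff M \<epsilon> h k j * r (real (n + 1 - j) * h) + b_coeff M \<epsilon> h k j * r (real (n - j) * h)))"
    using ig iA isum ic ib by (simp add: A0_hat_def Bochner_Integration.integral_sum)
  moreover have "norm (bracket ?D) \<le> bracket (\<lambda>v. B * M v)"
    by (rule Bochner_Integration.integral_norm_bound_integral[OF iD])
      (use diffusive_equilibriumD[OF M] pointwise in auto)
  ultimately show ?thesis
    using diffusive_equilibriumD[OF M] by (simp add: r_def \<tau>_def B_def)
qed

text \<open>The exact density and the scheme satisfy the same discrete Volterra equation up to the
consistency error, which is at most \<open>A \<epsilon>\<^sup>2 (1 - relax \<epsilon> t)\<close> for \<open>A = p / \<epsilon>\<^sup>2 + q\<close>.\<close>

lemma scheme_error: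
  assumes M: "diffusive_equilibrium M" and box: "\<And>i. a $ i < b $ i"
    and f: "kinetic_solution M a b T \<epsilon> f0 f" and k: "k \<in> frequencies a b"
    and eps: "\<epsilon> \<noteq> 0" and h: "0 < h" and p: "0 \<le> p" and q: "0 \<le> q" and T: "real N * h = T"
    and interp: "\<And>s t. 0 \<le> t \<Longrightarrow> t + h \<le> T \<Longrightarrow> 0 \<le> s \<Longrightarrow> s \<le> h \<Longrightarrow>
       norm (rho_hat a b f k (t + h - s) - (rho_hat a b f k (t + h) + complex_of_real s *
            ((rho_hat a b f k t - rho_hat a b f k (t + h)) / complex_of_real h))) \<le> p + s * q"
    and n: "n \<le> N"
  shows "norm (scheme M a b f0 \<epsilon> h k n - rho_hat a b f k (real n * h)) \<le> (p / \<epsilon>\<^sup>2 + q) * (real n * h)"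
proof (rule volterra_stability[where N = N
      and E = "\<lambda>n. norm (scheme M a b f0 \<epsilon> h k n - rho_hat a b f k (real n * h))", OF eps h _ _ _ n])
  let ?r = "rho_hat a b f k"
  let ?E = "\<lambda>n. norm (scheme M a b f0 \<epsilon> h k n - ?r (real n * h))"
  have T0: "0 \<le> T" using h unfolding T[symmetric] by simp
  show "0 \<le> p / \<epsilon>\<^sup>2 + q" using p q by simp
  show "?E 0 = 0" using kinetic_initial(2)[OF f T0, of k] by simp
  fix n assume n: "n < N"
  have nT: "real (n + 1) * h \<le> T"
    using n h unfolding T[symmetric] by (intro mult_right_mono) auto
  let ?R = "?r (real (n + 1) * h) - (A0_hat a b f0 \<epsilon> (real (n + 1) * h) k +
      (\<Sum>j\<le>n. c_coeff M \<epsilon> h k j * ?r (real (n + 1 - j) * h)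
               + b_coeff M \<epsilon> h k j * ?r (real (n - j) * h)))"
  have R: "norm ?R \<le> (p + \<epsilon>\<^sup>2 * q) * (1 - relax \<epsilon> (real (n + 1) * h))"
  proof (rule scheme_consistency[OF M box f k eps h q nT])
    fix j s assume j: "j \<le> n" and s: "real j * h \<le> s" "s \<le> real (j + 1) * h"
    from j obtain m where m: "n = j + m" by (rule le_Suc_ex[THEN exE])
    have e: "real (n + 1 - j) * h = real (n - j) * h + h" "real (n + 1) * h - s = real (n - j) * h + h - (s - real j * h)"
      unfolding m by (simp_all add: distrib_right)
    have "real (n - j) * h + h \<le> real (n + 1) * h"
      unfolding m using h by (simp add: distrib_right)
    with nT have le: "real (n - j) * h + h \<le> T" by (rule order_trans[rotated])
    have s': "0 \<le> s - real j * h" "s - real j * h \<le> h"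
      using s by (simp_all add: distrib_right)
    have "norm (?r (real (n + 1) * h - s) -
         (?r (real (n + 1 - j) * h) + complex_of_real (s - real j * h) *
            ((?r (real (n - j) * h) - ?r (real (n + 1 - j) * h)) / complex_of_real h))) \<le> p + (s - real j * h) * q"
      unfolding e by (rule interp[OF _ le s'])  (use h in simp)
    also have "\<dots> \<le> p + s * q"
      using q h by (intro add_left_mono mult_right_mono) auto
    finally show "norm (?r (real (n + 1) * h - s) -
         (?r (real (n + 1 - j) * h) + complex_of_real (s - real j * h) *
            ((?r (real (n - j) * h) - ?r (real (n + 1 - j) * h)) / complex_of_real h))) \<le> p + s * q" .
  qed
  have pq: "p + \<epsilon>\<^sup>2 * q = (p / \<epsilon>\<^sup>2 + q) * \<epsilon>\<^sup>2"
    using eps by (simp add: distrib_right)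
  have error: "scheme M a b f0 \<epsilon> h k (Suc n) - ?r (real (Suc n) * h)
      = (\<Sum>j\<le>n. c_coeff M \<epsilon> h k j * (scheme M a b f0 \<epsilon> h k (n + 1 - j) - ?r (real (n + 1 - j) * h))
               + b_coeff M \<epsilon> h k j * (scheme M a b f0 \<epsilon> h k (n - j) - ?r (real (n - j) * h))) - ?R"
  proof -
    have "(\<Sum>j\<le>n. c_coeff M \<epsilon> h k j * (scheme M a b f0 \<epsilon> h k (n + 1 - j) - ?r (real (n + 1 - j) * h))
               + b_coeff M \<epsilon> h k j * (scheme M a b f0 \<epsilon> h k (n - j) - ?r (real (n - j) * h)))
      = (\<Sum>j\<le>n. c_coeff M \<epsilon> h k j * scheme M a b f0 \<epsilon> h k (n + 1 - j)
                + b_coeff M \<epsilon> h k j * scheme M a b f0 \<epsilon> h k (n - j))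
        - (\<Sum>j\<le>n. c_coeff M \<epsilon> h k j * ?r (real (n + 1 - j) * h)
                + b_coeff M \<epsilon> h k j * ?r (real (n - j) * h))"
      unfolding sum_subtractf[symmetric] by (intro sum.cong refl) (simp only: algebra_simps)
    then show ?thesis
      unfolding scheme_implicit[OF M eps h] by (simp only: Suc_eq_plus1) (simp only: algebra_simps)
  qed
  have bound: "norm ((\<Sum>j\<le>n. c_coeff M \<epsilon> h k j * (scheme M a b f0 \<epsilon> h k (n + 1 - j) - ?r (real (n + 1 - j) * h))
               + b_coeff M \<epsilon> h k j * (scheme M a b f0 \<epsilon> h k (n - j) - ?r (real (n - j) * h))) - ?R) \<le> (\<Sum>j\<le>n. c_majorant \<epsilon> h j * ?E (n + 1 - j) + b_majorant \<epsilon> h j * ?E (n - j))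
      + (p / \<epsilon>\<^sup>2 + q) * \<epsilon>\<^sup>2 * (1 - relax \<epsilon> (real (n + 1) * h))"
  proof (rule order_trans[OF norm_triangle_ineq4 add_mono[OF sum_norm_le R[unfolded pq]]])
    fix j
    show "norm (c_coeff M \<epsilon> h k j * (scheme M a b f0 \<epsilon> h k (n + 1 - j) - ?r (real (n + 1 - j) * h))
               + b_coeff M \<epsilon> h k j * (scheme M a b f0 \<epsilon> h k (n - j) - ?r (real (n - j) * h)))
          \<le> c_majorant \<epsilon> h j * ?E (n + 1 - j) + b_majorant \<epsilon> h j * ?E (n - j)"
      by (rule order_trans[OF norm_triangle_ineq])
        (auto simp: norm_mult intro!: add_mono mult_right_mono c_coeff_bounds[OF M eps h] b_coeff_bounds[OF M eps h])
  qed
  show "?E (Suc n) \<le> (\<Sum>j\<le>n. c_majorant \<epsilon> h j * ?E (n + 1 - j) + b_majorant \<epsilon> h j * ?E (n - j))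
      + (p / \<epsilon>\<^sup>2 + q) * \<epsilon>\<^sup>2 * (1 - relax \<epsilon> (real (n + 1) * h))"
    unfolding error by (rule bound)
qed

lemma norm_increment_le:
  fixes u :: "real \<Rightarrow> complex"
  assumes "x \<le> y" and u: "\<And>t. t \<in> {x..y} \<Longrightarrow> (u has_vector_derivative u' t) (at t within {x..y})"
    and B: "\<And>t. t \<in> {x..y} \<Longrightarrow> norm (u' t) \<le> B"
  shows "norm (u y - u x) \<le> B * (y - x)"
proof (cases "x = y")
  case False
  have "norm (u y - u x) \<le> B * y - B * x"
  proof (rule differentiable_bound_general)
    show "x < y" using assms(1) False by simp
    show "continuous_on {x..y} u" by (rule continuous_on_vector_derivative[OF u])
    show "continuous_on {x..y} (\<lambda>t. B * t)" by (intro continuous_intros)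
    show "(u has_vector_derivative u' t) (at t)" if "x < t" "t < y" for t
    proof -
      have "t \<in> interior {x..y}" using that by auto
      then show ?thesis using u[of t] that at_within_interior by fastforce
    qed
    show "((\<lambda>t. B * t) has_vector_derivative B) (at t)" for t
      by (auto intro!: derivative_eq_intros simp flip: has_real_derivative_iff_has_vector_derivative)
    show "norm (u' t) \<le> B" if "x < t" "t < y" for t using B that by auto
  qed
  then show ?thesis by (simp add: algebra_simps)
qed simp

text \<open>On an interval of length \<open>h\<close> the derivative of \<open>r\<close> differs from the slope of the chord by at most
\<open>K h\<close>; integrating from the end point \<open>t + h\<close>, where the interpolation is exact, gives the factor
\<open>s\<close>. This factor is what makes the error estimate uniform in \<open>\<epsilon>\<close>.\<close>

lemma linear_interpolation_error:
  fixes r :: "real \<Rightarrow> complex"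
  assumes d: "\<And>t. t \<in> {0..T} \<Longrightarrow> (r has_vector_derivative r' t) (at t within {0..T})"
    and d2: "\<And>t. t \<in> {0..T} \<Longrightarrow> (r' has_vector_derivative r'' t) (at t within {0..T})"
    and K: "\<And>t. t \<in> {0..T} \<Longrightarrow> norm (r'' t) \<le> K"
    and t: "0 \<le> t" "t + h \<le> T" and s: "0 \<le> s" "s \<le> h" and h: "0 < h"
  shows "norm (r (t + h - s) - (r (t + h) + complex_of_real s * ((r t - r (t + h)) / complex_of_real h)))
     \<le> K * h * s"
proof -
  define m where "m = (r (t + h) - r t) / complex_of_real h"
  have K0: "0 \<le> K" using K[of t] t h by (intro order_trans[OF norm_ge_zero]) auto
  have sub: "{t..t + h} \<subseteq> {0..T}" using t by auto
  have r1: "(r has_vector_derivative r' x) (at x within S)" if "x \<in> {0..T}" "S \<subseteq> {0..T}" for x S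
    using has_vector_derivative_within_subset[OF d] that by auto
  have r2: "(r' has_vector_derivative r'' x) (at x within S)" if "x \<in> {0..T}" "S \<subseteq> {0..T}" for x S
    using has_vector_derivative_within_subset[OF d2] that by auto
  have r'_close: "norm (r' y - r' x) \<le> K * h" if xy: "x \<in> {t..t + h}" "y \<in> {t..t + h}" for x y
  proof -
    have main: "norm (r' y - r' x) \<le> K * h" if "x \<le> y" "x \<in> {t..t + h}" "y \<in> {t..t + h}" for x y
    proof -
      have "norm (r' y - r' x) \<le> K * (y - x)"
        by (rule norm_increment_le[OF that(1) r2]) (use that t K in auto)
      also have "\<dots> \<le> K * h" using that K0 by (intro mult_left_mono) auto
      finally show ?thesis .
    qed
    show ?thesis
      using main[of x y] main[of y x] xy by (cases "x \<le> y") (auto simp: norm_minus_commute)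
  qed
  have slope: "norm (r' x - m) \<le> K * h" if x: "x \<in> {t..t + h}" for x
  proof -
    have "norm ((r (t + h) - complex_of_real (t + h) * r' x) - (r t - complex_of_real t * r' x))
        \<le> K * h * (t + h - t)"
    proof (rule norm_increment_le)
      show "((\<lambda>y. r y - complex_of_real y * r' x) has_vector_derivative r' y - r' x) (at y within {t..t + h})"
        if "y \<in> {t..t + h}" for y
        using that sub by (auto intro!: derivative_eq_intros r1)
      show "norm (r' y - r' x) \<le> K * h" if "y \<in> {t..t + h}" for y
        using r'_close x that .
    qed (use h in simp)
    also have "(r (t + h) - complex_of_real (t + h) * r' x) - (r t - complex_of_real t * r' x)
        = complex_of_real h * (m - r' x)"
      using h by (simp add: m_def field_simps)
    finally show ?thesis
      using h by (simp add: norm_mult norm_minus_commute)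
  qed
  have "norm ((r (t + h) - complex_of_real (t + h) * m) - (r (t + h - s) - complex_of_real (t + h - s) * m))
      \<le> K * h * (t + h - (t + h - s))"
  proof (rule norm_increment_le)
    show "((\<lambda>y. r y - complex_of_real y * m) has_vector_derivative r' y - m) (at y within {t + h - s..t + h})"
      if "y \<in> {t + h - s..t + h}" for y
      using that sub s by (auto intro!: derivative_eq_intros r1)
    show "norm (r' y - m) \<le> K * h" if "y \<in> {t + h - s..t + h}" for y
      using slope that s by auto
  qed (use s in simp)
  also have "(r (t + h) - complex_of_real (t + h) * m) - (r (t + h - s) - complex_of_real (t + h - s) * m)
      = - (r (t + h - s) - (r (t + h) + complex_of_real s * ((r t - r (t + h)) / complex_of_real h)))"
    using h by (simp add: m_def field_simps)
  finally show ?thesis by (simp only: norm_minus_cancel diff_diff_eq2 add_diff_cancel_left')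
qed

lemma scheme_first_order:
  assumes M: "diffusive_equilibrium M" and box: "\<And>i. a $ i < b $ i" and "0 < T"
    and eps: "0 < \<epsilon>" and k: "k \<in> frequencies a b" and f: "kinetic_solution M a b T \<epsilon> f0 f"
    and K: "time_derivatives_bounded T K (rho_hat a b f k)" and h: "real N * h = T" and n: "n \<le> N"
  shows "norm (scheme M a b f0 \<epsilon> h k n - rho_hat a b f k (real n * h)) \<le> K * T * h"
proof -
  have h0: "0 < h" using \<open>0 < T\<close> h by (metis mult_nonneg_nonpos not_less of_nat_0_le_iff)
  obtain r' r'' where r: "\<And>t. t \<in> {0..T} \<Longrightarrow> (rho_hat a b f k has_vector_derivative r' t) (at t within {0..T})"
      "\<And>t. t \<in> {0..T} \<Longrightarrow> (r' has_vector_derivative r'' t) (at t within {0..T})"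
      "\<And>t. t \<in> {0..T} \<Longrightarrow> norm (r'' t) \<le> K"
    using K unfolding time_derivatives_bounded_def by blast
  have K0: "0 \<le> K" using r(3)[of 0] \<open>0 < T\<close> by (intro order_trans[OF norm_ge_zero]) auto
  have "norm (scheme M a b f0 \<epsilon> h k n - rho_hat a b f k (real n * h)) \<le> (0 / \<epsilon>\<^sup>2 + K * h) * (real n * h)"
  proof (rule scheme_error[OF M box f k _ h0 _ _ h _ n])
    fix s t assume "0 \<le> t" "t + h \<le> T" "0 \<le> s" "s \<le> h"
    from linear_interpolation_error[OF r this h0]
    show "norm (rho_hat a b f k (t + h - s) - (rho_hat a b f k (t + h) + complex_of_real s *
            ((rho_hat a b f k t - rho_hat a b f k (t + h)) / complex_of_real h))) \<le> 0 + s * (K * h)"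
      by (simp add: mult.commute mult.left_commute)
  qed (use eps K0 h0 in auto)
  also have "\<dots> \<le> K * h * T"
    unfolding h[symmetric] using K0 h0 n by (simp add: mult_left_mono mult_right_mono)
  finally show ?thesis by (simp add: mult.commute mult.left_commute)
qed

text \<open>Uniform continuity of the density bounds the interpolation error by \<open>2 \<eta>\<close>, and \<open>scheme_error\<close> then
loses the factor \<open>T / \<epsilon>\<^sup>2\<close>, which is harmless for fixed \<open>\<epsilon>\<close>.\<close>

lemma scheme_grid_convergent:
  assumes M: "diffusive_equilibrium M" and box: "\<And>i. a $ i < b $ i" and T: "0 < T"
    and eps: "0 < \<epsilon>" and k: "k \<in> frequencies a b" and f: "kinetic_solution M a b T \<epsilon> f0 f"
  shows "grid_convergent T (\<lambda>N. scheme M a b f0 \<epsilon> (T / real N) k) (rho_hat a b f k)"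
  unfolding grid_convergent_def
proof (intro allI impI)
  fix e :: real assume e: "0 < e"
  let ?r = "rho_hat a b f k"
  \<comment> \<open>\<open>scheme_error\<close> returns \<open>2 \<eta> T / \<epsilon>\<^sup>2\<close>, which is half of \<open>e\<close>.\<close>
  define \<eta> where "\<eta> = e * \<epsilon>\<^sup>2 / (4 * T)"
  have \<eta>: "0 < \<eta>" using e eps T by (simp add: \<eta>_def)
  have "uniformly_continuous_on {0..T} ?r"
    by (rule compact_uniformly_continuous[OF rho_hat_continuous[OF M f]]) simp
  then obtain d where d: "d > 0" "\<And>x y. x \<in> {0..T} \<Longrightarrow> y \<in> {0..T} \<Longrightarrow> dist y x < d \<Longrightarrow> dist (?r y) (?r x) < \<eta>"
    using \<eta> unfolding uniformly_continuous_on_def by meson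
  have "(\<lambda>N. T / real N) \<longlonglongrightarrow> 0"
    by (rule lim_const_over_n)
  then have "\<forall>\<^sub>F N in sequentially. T / real N < d"
    using d(1) by (rule order_tendstoD)
  then show "\<forall>\<^sub>F N in sequentially. \<forall>n\<le>N.
      norm (scheme M a b f0 \<epsilon> (T / real N) k n - ?r (real n * (T / real N))) < e"
    using eventually_gt_at_top[of 0]
  proof eventually_elim
    case (elim N)
    define h where "h = T / real N"
    have h: "0 < h" "h < d" "real N * h = T" using elim T by (auto simp: h_def)
    show ?case
    proof (intro allI impI)
      fix n assume n: "n \<le> N"
      have "norm (scheme M a b f0 \<epsilon> h k n - ?r (real n * h)) \<le> (2 * \<eta> / \<epsilon>\<^sup>2 + 0) * (real n * h)"
      proof (rule scheme_error[OF M box f k _ h(1) _ _ h(3) _ n])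
        fix s t assume st: "0 \<le> t" "t + h \<le> T" "0 \<le> s" "s \<le> h"
        have 1: "norm (?r (t + h - s) - ?r (t + h)) < \<eta>"
          using d(2)[of "t + h" "t + h - s"] st h by (auto simp: dist_norm)
        have 2: "norm (?r t - ?r (t + h)) < \<eta>"
          using d(2)[of "t + h" t] st h by (auto simp: dist_norm)
        have "norm (complex_of_real s * ((?r t - ?r (t + h)) / complex_of_real h))
            = s / h * norm (?r t - ?r (t + h))"
          using st h by (simp add: norm_mult norm_divide)
        also have "\<dots> \<le> 1 * norm (?r t - ?r (t + h))"
          using st h by (intro mult_right_mono) auto
        finally have 3: "norm (complex_of_real s * ((?r t - ?r (t + h)) / complex_of_real h)) \<le> \<eta>"
          using 2 by simp
        show "norm (?r (t + h - s) - (?r (t + h) + complex_of_real s * ((?r t - ?r (t + h)) / complex_of_real h)))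
            \<le> 2 * \<eta> + s * 0"
          using norm_triangle_ineq4[of "?r (t + h - s) - ?r (t + h)"
              "complex_of_real s * ((?r t - ?r (t + h)) / complex_of_real h)"] 1 3
          by (simp add: algebra_simps)
      qed (use eps \<eta> in auto)
      also have "\<dots> \<le> 2 * \<eta> / \<epsilon>\<^sup>2 * T"
        unfolding h(3)[symmetric] add_0_right using \<eta> h n by (intro mult_left_mono mult_right_mono) auto
      also have "\<dots> < e"
        using e eps T by (simp add: \<eta>_def field_simps)
      finally show "norm (scheme M a b f0 \<epsilon> (T / real N) k n - ?r (real n * (T / real N))) < e"
        by (simp add: h_def)
    qed
  qed
qed

section \<open>Conservation of mass\<close>

lemma coefficients_at_zero_frequency:
  assumes M: "diffusive_equilibrium M"
  shows "c_coeff M \<epsilon> h 0 j = complex_of_real (c_majorant \<epsilon> h j)"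
    and "b_coeff M \<epsilon> h 0 j = complex_of_real (b_majorant \<epsilon> h j)"
    and "A0_hat a b f0 \<epsilon> t 0 = complex_of_real (relax \<epsilon> t) * rho0_hat a b f0 0"
proof -
  have [simp]: "symb \<epsilon> 0 v = 1" for v :: "real^'d" by (simp add: symb_def)
  show "c_coeff M \<epsilon> h 0 j = complex_of_real (c_majorant \<epsilon> h j)"
    using diffusive_equilibriumD[OF M] by (simp add: c_coeff_eq c_majorant_eq)
  show "b_coeff M \<epsilon> h 0 j = complex_of_real (b_majorant \<epsilon> h j)"
    using diffusive_equilibriumD[OF M] by (simp add: b_coeff_eq b_majorant_eq)
  show "A0_hat a b f0 \<epsilon> t 0 = complex_of_real (relax \<epsilon> t) * rho0_hat a b f0 0"
    by (simp add: A0_hat_def rho0_hat_def decay_eq_damp damp_one)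
qed

text \<open>If all earlier values equal the initial mass, the initial layer contributes the fraction
\<open>relax \<epsilon> t\<close> of it and the weights contribute the remaining fraction \<open>1 - relax \<epsilon> t\<close>.\<close>

lemma scheme_mass_conservation:
  assumes M: "diffusive_equilibrium M" and eps: "\<epsilon> \<noteq> 0" and h: "0 < h"
  shows "scheme M a b f0 \<epsilon> h 0 n = scheme M a b f0 \<epsilon> h 0 0"
proof (induction n rule: less_induct)
  case (less n)
  show ?case
  proof (cases n)
    case (Suc m)
    let ?S = "scheme M a b f0 \<epsilon> h 0" and ?c = "c_coeff M \<epsilon> h 0" and ?b = "b_coeff M \<epsilon> h 0"
    have split: "(\<Sum>j\<le>m. F j) = F 0 + (\<Sum>j=1..m. F j)" for F :: "nat \<Rightarrow> complex"
    proof -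
      have "{..m} = insert 0 {1..m}" by auto
      then show ?thesis by simp
    qed
    have m: "?S m = ?S 0" using less[of m] Suc by auto
    have "(\<Sum>j=1..m. ?c j * ?S (m + 1 - j) + ?b j * ?S (m - j)) = (\<Sum>j=1..m. (?c j + ?b j) * ?S 0)"
    proof (intro sum.cong refl)
      fix j assume "j \<in> {1..m}"
      then have "?S (m + 1 - j) = ?S 0" "?S (m - j) = ?S 0"
        using less[of "m + 1 - j"] less[of "m - j"] Suc by auto
      then show "?c j * ?S (m + 1 - j) + ?b j * ?S (m - j) = (?c j + ?b j) * ?S 0"
        by (simp only: distrib_right)
    qed
    then have tail: "(\<Sum>j=1..m. ?c j * ?S (m + 1 - j) + ?b j * ?S (m - j)) = (\<Sum>j=1..m. ?c j + ?b j) * ?S 0"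
      by (simp only: sum_distrib_right)
    have "(\<Sum>j\<le>m. ?c j * ?S (m + 1 - j) + ?b j * ?S (m - j)) - ?c 0 * ?S (m + 1)
        = (\<Sum>j\<le>m. ?c j + ?b j) * ?S 0 - ?c 0 * ?S 0"
      by (simp only: split tail m diff_zero) (simp only: algebra_simps)
    also have "(\<Sum>j\<le>m. ?c j + ?b j) = complex_of_real (1 - relax \<epsilon> (real (m + 1) * h))"
      unfolding coefficients_at_zero_frequency[OF M] sum_majorants[symmetric] by simp
    finally have sum: "(\<Sum>j\<le>m. ?c j * ?S (m + 1 - j) + ?b j * ?S (m - j)) - ?c 0 * ?S (m + 1)
        = complex_of_real (1 - relax \<epsilon> (real (m + 1) * h)) * ?S 0 - ?c 0 * ?S 0" .
    have implicit: "?S (m + 1) = A0_hat a b f0 \<epsilon> (real (m + 1) * h) 0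
        + (\<Sum>j\<le>m. ?c j * ?S (m + 1 - j) + ?b j * ?S (m - j))"
      unfolding Suc_eq_plus1[symmetric, of m] by (rule scheme_implicit[OF M eps h, unfolded Suc_eq_plus1[symmetric]])
    have collect: "(1 - c) * x = (1 - c) * s"
      if "x = A + y" "y - c * x = e * s - c * s" "A = (1 - e) * s" for x A y c e s :: complex
      using that by algebra
    have "(1 - ?c 0) * ?S (m + 1) = (1 - ?c 0) * ?S 0"
      by (rule collect[OF implicit sum]) (simp add: coefficients_at_zero_frequency(3)[OF M])
    then show ?thesis
      using c_coeff_0_neq_1[OF M eps h, of 0] Suc by (simp del: scheme.simps)
  qed simp
qed

section \<open>The limit of vanishing Knudsen number\<close>

lemma bracket_tendsto_at_right:
  fixes w :: "real \<Rightarrow> real^'d \<Rightarrow> complex"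
  assumes g: "integrable lborel g"
    and w: "\<And>\<epsilon>. w \<epsilon> \<in> borel_measurable borel" "w0 \<in> borel_measurable borel"
    and B: "\<And>\<epsilon> v. norm (w \<epsilon> v) \<le> B"
    and lim: "\<And>v. ((\<lambda>\<epsilon>. w \<epsilon> v) \<longlongrightarrow> w0 v) (at_right 0)"
  shows "((\<lambda>\<epsilon>. bracket (\<lambda>v. w \<epsilon> v * g v)) \<longlongrightarrow> bracket (\<lambda>v. w0 v * g v)) (at_right 0)"
  unfolding tendsto_at_iff_sequentially o_def
proof (intro allI impI)
  fix X :: "nat \<Rightarrow> real"
  assume X: "\<forall>i. X i \<in> {0<..} - {0}" "X \<longlonglongrightarrow> 0"
  show "(\<lambda>i. bracket (\<lambda>v. w (X i) v * g v)) \<longlonglongrightarrow> bracket (\<lambda>v. w0 v * g v)"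
  proof (rule integral_dominated_convergence)
    show "integrable lborel (\<lambda>v. B * norm (g v))" using g by simp
    show "AE v in lborel. (\<lambda>i. w (X i) v * g v) \<longlonglongrightarrow> w0 v * g v"
    proof (intro always_eventually allI tendsto_mult tendsto_const)
      show "(\<lambda>i. w (X i) v) \<longlonglongrightarrow> w0 v" for v
        using lim[of v] X unfolding tendsto_at_iff_sequentially o_def by blast
    qed
    show "AE v in lborel. norm (w (X i) v * g v) \<le> B * norm (g v)" for i
      using B by (auto simp: norm_mult intro!: mult_right_mono)
  qed (use w g in \<open>auto intro!: borel_measurable_times\<close>)
qed

lemma norm_symb_ge_1: "1 \<le> norm (symb \<epsilon> k v)"
  using abs_Re_le_cmod[of "symb \<epsilon> k v"] by simp

lemma symb_tendsto_1: "((\<lambda>\<epsilon>. symb \<epsilon> k v) \<longlongrightarrow> 1) (at_right 0)"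
proof -
  have "((\<lambda>\<epsilon>. symb \<epsilon> k v) \<longlongrightarrow> 1 + \<i> * complex_of_real (0 * (k \<bullet> v))) (at_right 0)"
    unfolding symb_def by (intro tendsto_intros)
  then show ?thesis by simp
qed

lemma relax_over_square_tendsto_0:
  assumes "0 < s"
  shows "((\<lambda>\<epsilon>. relax \<epsilon> s / \<epsilon>\<^sup>2) \<longlongrightarrow> 0) (at_right 0)"
  unfolding relax_def using assms by real_asymp

lemma relax_tendsto_0:
  assumes "0 < s"
  shows "((\<lambda>\<epsilon>. relax \<epsilon> s) \<longlongrightarrow> 0) (at_right 0)"
  unfolding relax_def using assms by real_asymp

lemma decay_tendsto_0:
  assumes "0 < s"
  shows "((\<lambda>\<epsilon>. decay \<epsilon> k s v) \<longlongrightarrow> 0) (at_right 0)"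
  using relax_tendsto_0[OF assms] by (subst tendsto_norm_zero_iff[symmetric]) (simp add: norm_decay)

lemma relax_le_1: "0 \<le> s \<Longrightarrow> relax \<epsilon> s \<le> 1"
  using relax_mono[of 0 s \<epsilon>] by simp

lemma measurable_symb_quotients:
  "(\<lambda>v. 1 / symb \<epsilon> k v) \<in> borel_measurable borel"
  "(\<lambda>v. (1 - decay \<epsilon> k h v) / (symb \<epsilon> k v)\<^sup>2) \<in> borel_measurable borel"
  "(\<lambda>v. decay \<epsilon> k h v / symb \<epsilon> k v) \<in> borel_measurable borel"
  by (intro borel_measurable_continuous_onI continuous_intros; simp)+

lemma norm_symb_quotients_le:
  shows "norm (1 / symb \<epsilon> k v) \<le> 1"
    and "0 \<le> h \<Longrightarrow> norm ((1 - decay \<epsilon> k h v) / (symb \<epsilon> k v)\<^sup>2) \<le> 2"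
proof -
  show "norm (1 / symb \<epsilon> k v) \<le> 1"
    using norm_symb_ge_1[of \<epsilon> k v] by (simp add: norm_divide divide_le_eq_1)
  assume h: "0 \<le> h"
  have "norm (1 - decay \<epsilon> k h v) \<le> 1 + 1"
    using norm_triangle_ineq4[of 1 "decay \<epsilon> k h v"] relax_le_1[OF h, of \<epsilon>] by (simp add: norm_decay)
  then show "norm ((1 - decay \<epsilon> k h v) / (symb \<epsilon> k v)\<^sup>2) \<le> 2"
    using frac_le[of 2 "norm (1 - decay \<epsilon> k h v)" 1 "(norm (symb \<epsilon> k v))\<^sup>2"] norm_symb_ge_1[of \<epsilon> k v]
    by (simp add: norm_divide norm_power one_le_power)
qed

lemma equilibrium_moments:
  assumes M: "diffusive_equilibrium M"
  shows "integrable lborel (\<lambda>v. (k \<bullet> v) * M v)" "bracket (\<lambda>v. (k \<bullet> v) * M v) = 0"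
    and "integrable lborel (\<lambda>v. (k \<bullet> v)\<^sup>2 * M v)"
proof -
  have eq: "(\<lambda>v. (k \<bullet> v) * M v) = (\<lambda>v. k \<bullet> (M v *\<^sub>R v))"
    by (simp add: fun_eq_iff mult.commute)
  have mean: "integrable lborel (\<lambda>v. M v *\<^sub>R v)" "bracket (\<lambda>v. M v *\<^sub>R v) = 0"
    and second: "\<And>i j. integrable lborel (\<lambda>v. v $ i * v $ j * M v)"
    using M by (auto simp: diffusive_equilibrium_def)
  show "integrable lborel (\<lambda>v. (k \<bullet> v) * M v)"
    unfolding eq by (intro integrable_inner_right mean)
  show "bracket (\<lambda>v. (k \<bullet> v) * M v) = 0"
    unfolding eq using integral_inner_right[OF mean(1), of k] mean(2) by simp
  have square: "(\<lambda>v. (k \<bullet> v)\<^sup>2 * M v) = (\<lambda>v. \<Sum>i\<in>UNIV. \<Sum>j\<in>UNIV. k $ i * k $ j * (v $ i * v $ j * M v))"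
    by (intro ext, simp only: inner_vec_def inner_real_def power2_eq_square sum_product, simp only: sum_distrib_right)
      (intro sum.cong refl, simp add: ac_simps)
  show "integrable lborel (\<lambda>v. (k \<bullet> v)\<^sup>2 * M v)"
    unfolding square by (intro Bochner_Integration.integrable_sum integrable_mult_right second)
qed

lemma diffusion_coeff_nonneg:
  assumes M: "diffusive_equilibrium M"
  shows "0 \<le> diffusion_coeff M k"
  unfolding diffusion_coeff_def
  using diffusive_equilibriumD(2)[OF M] by (intro Bochner_Integration.integral_nonneg) auto

text \<open>With \<open>\<kappa> = k \<bullet> v\<close> one has \<open>1 - 1 / \<sigma> = \<i> \<epsilon> \<kappa> + \<epsilon>\<^sup>2 \<kappa>\<^sup>2 / \<sigma>\<close>. The term of order \<open>\<epsilon>\<close> averages to zero since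
\<open>M\<close> has mean velocity zero, so \<open>1 - c\<^sub>0\<close> is of order \<open>\<epsilon>\<^sup>2\<close>, and what multiplies \<open>\<epsilon>\<^sup>2\<close> has a limit by
dominated convergence.\<close>

lemma leading_coefficients_expansion:
  fixes M :: "real^'d \<Rightarrow> real" and k :: "real^'d"
  assumes M: "diffusive_equilibrium M" and eps: "0 < \<epsilon>" and h: "0 < h"
  defines "R \<equiv> bracket (\<lambda>v. 1 / symb \<epsilon> k v * complex_of_real ((k \<bullet> v)\<^sup>2 * M v))"
    and "Q \<equiv> bracket (\<lambda>v. (1 - decay \<epsilon> k h v) / (symb \<epsilon> k v)\<^sup>2 * complex_of_real (M v))"
    and "P \<equiv> bracket (\<lambda>v. decay \<epsilon> k h v / symb \<epsilon> k v * complex_of_real (M v))"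
  shows "(1 - c_coeff M \<epsilon> h k 0) / complex_of_real (\<epsilon>\<^sup>2) = R + Q / complex_of_real h"
    and "b_coeff M \<epsilon> h k 0 / complex_of_real (\<epsilon>\<^sup>2) = Q / complex_of_real h - P / complex_of_real (\<epsilon>\<^sup>2)"
    and "norm P \<le> relax \<epsilon> h"
proof -
  note meas = measurable_symb_quotients(1)[of \<epsilon> k] measurable_symb_quotients(2,3)[of \<epsilon> k h]
  have bP: "norm (decay \<epsilon> k h v / symb \<epsilon> k v) \<le> relax \<epsilon> h" for v
    using frac_le[of "relax \<epsilon> h" "relax \<epsilon> h" 1 "norm (symb \<epsilon> k v)"] norm_symb_ge_1[of \<epsilon> k v]
      less_imp_le[OF relax_pos] by (simp add: norm_divide norm_decay)
  note mom = equilibrium_moments[OF M, of k]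
  have i1: "integrable lborel (\<lambda>v. complex_of_real ((k \<bullet> v) * M v))"
    using mom(1) by (rule integrable_of_real)
  have i2: "integrable lborel (\<lambda>v. 1 / symb \<epsilon> k v * complex_of_real ((k \<bullet> v)\<^sup>2 * M v))"
    by (rule integrable_bounded_mult[OF integrable_of_real[OF mom(3)] _ norm_symb_quotients_le(1)]) (use meas in simp)
  have i3: "integrable lborel (\<lambda>v. (1 - decay \<epsilon> k h v) / (symb \<epsilon> k v)\<^sup>2 * complex_of_real (M v))"
    by (rule bracket_equilibrium_bound(1)[OF M meas(2) norm_symb_quotients_le(2)[OF less_imp_le[OF h]]])
  have i4: "integrable lborel (\<lambda>v. decay \<epsilon> k h v / symb \<epsilon> k v * complex_of_real (M v))"
    by (rule bracket_equilibrium_bound(1)[OF M meas(3) bP])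
  show "norm P \<le> relax \<epsilon> h"
    unfolding P_def by (rule bracket_equilibrium_bound(2)[OF M meas(3) bP])
  have cw: "(1 - c_weight \<epsilon> h 0 (symb \<epsilon> k v)) * complex_of_real (M v)
      = \<i> * complex_of_real \<epsilon> * complex_of_real ((k \<bullet> v) * M v)
        + complex_of_real (\<epsilon>\<^sup>2) * (1 / symb \<epsilon> k v * complex_of_real ((k \<bullet> v)\<^sup>2 * M v))
        + complex_of_real (\<epsilon>\<^sup>2 / h) * ((1 - decay \<epsilon> k h v) / (symb \<epsilon> k v)\<^sup>2 * complex_of_real (M v))" for v
  proof -
    define \<kappa> where "\<kappa> = complex_of_real (k \<bullet> v)"
    define \<sigma> where "\<sigma> = symb \<epsilon> k v"
    have \<sigma>: "\<sigma> \<noteq> 0" "\<sigma> = 1 + \<i> * complex_of_real \<epsilon> * \<kappa>"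
      unfolding \<sigma>_def \<kappa>_def by (rule symb_nonzero) (simp add: symb_def)
    have "1 - 1 / \<sigma> = \<i> * complex_of_real \<epsilon> * \<kappa> + (complex_of_real \<epsilon>)\<^sup>2 * (1 / \<sigma> * \<kappa>\<^sup>2)"
    proof -
      have "\<sigma> - 1 = \<i> * complex_of_real \<epsilon> * \<kappa> * \<sigma> + (complex_of_real \<epsilon>)\<^sup>2 * \<kappa>\<^sup>2"
        unfolding \<sigma>(2) by (simp add: algebra_simps power2_eq_square)
      then show ?thesis using \<sigma>(1) by (simp add: field_simps)
    qed
    moreover have "c_weight \<epsilon> h 0 \<sigma> = 1 / \<sigma> - complex_of_real (\<epsilon>\<^sup>2 / h) * ((1 - decay \<epsilon> k h v) / \<sigma>\<^sup>2)"
      by (simp add: c_weight_def decay_eq_damp \<sigma>_def)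
    ultimately have "1 - c_weight \<epsilon> h 0 \<sigma> = \<i> * complex_of_real \<epsilon> * \<kappa> + (complex_of_real \<epsilon>)\<^sup>2 * (1 / \<sigma> * \<kappa>\<^sup>2)
        + complex_of_real (\<epsilon>\<^sup>2 / h) * ((1 - decay \<epsilon> k h v) / \<sigma>\<^sup>2)"
      by simp
    then show ?thesis
      unfolding \<sigma>_def[symmetric] by (simp only:) (simp add: \<kappa>_def distrib_right mult.assoc)
  qed
  have iX: "integrable lborel (\<lambda>v. \<i> * complex_of_real \<epsilon> * complex_of_real ((k \<bullet> v) * M v))"
    and iY: "integrable lborel (\<lambda>v. complex_of_real (\<epsilon>\<^sup>2) * (1 / symb \<epsilon> k v * complex_of_real ((k \<bullet> v)\<^sup>2 * M v)))"
    and iZ: "integrable lborel (\<lambda>v. complex_of_real (\<epsilon>\<^sup>2 / h) *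
        ((1 - decay \<epsilon> k h v) / (symb \<epsilon> k v)\<^sup>2 * complex_of_real (M v)))"
    by (intro integrable_mult_right i1 i2 i3)+
  have "1 - c_coeff M \<epsilon> h k 0 = bracket (\<lambda>v. (1 - c_weight \<epsilon> h 0 (symb \<epsilon> k v)) * complex_of_real (M v))"
    using diffusive_equilibriumD(5,6)[OF M] c_coeff_bounds(2)[OF M _ h, of \<epsilon> 0 k] eps
    by (simp add: left_diff_distrib c_coeff_eq)
  also have "\<dots> = \<i> * complex_of_real \<epsilon> * complex_of_real (bracket (\<lambda>v. (k \<bullet> v) * M v))
      + complex_of_real (\<epsilon>\<^sup>2) * R + complex_of_real (\<epsilon>\<^sup>2 / h) * Q"
    unfolding cw R_def Q_def integral_complex_of_real[symmetric] integral_mult_right_zero[symmetric]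
    by (simp only: Bochner_Integration.integral_add[OF Bochner_Integration.integrable_add[OF iX iY] iZ]
          Bochner_Integration.integral_add[OF iX iY])
  also have "\<dots> = complex_of_real (\<epsilon>\<^sup>2) * (R + Q / complex_of_real h)"
    by (simp only: mom(2)) (simp add: algebra_simps)
  finally show "(1 - c_coeff M \<epsilon> h k 0) / complex_of_real (\<epsilon>\<^sup>2) = R + Q / complex_of_real h"
    using eps by simp
  have "b_coeff M \<epsilon> h k 0 = bracket (\<lambda>v. complex_of_real (\<epsilon>\<^sup>2 / h) *
      ((1 - decay \<epsilon> k h v) / (symb \<epsilon> k v)\<^sup>2 * complex_of_real (M v))
      - decay \<epsilon> k h v / symb \<epsilon> k v * complex_of_real (M v))"
    unfolding b_coeff_eq
    by (intro Bochner_Integration.integral_cong refl) (simp add: b_weight_def decay_eq_damp left_diff_distrib)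
  also have "\<dots> = complex_of_real (\<epsilon>\<^sup>2 / h) * Q - P"
    unfolding P_def Q_def integral_mult_right_zero[symmetric]
    by (rule Bochner_Integration.integral_diff) (intro integrable_mult_right i3 i4)+
  finally show "b_coeff M \<epsilon> h k 0 / complex_of_real (\<epsilon>\<^sup>2) = Q / complex_of_real h - P / complex_of_real (\<epsilon>\<^sup>2)"
    using eps by (simp add: diff_divide_distrib)
qed

lemma leading_coefficients_tendsto:
  fixes M :: "real^'d \<Rightarrow> real"
  assumes M: "diffusive_equilibrium M" and h: "0 < h"
  shows "((\<lambda>\<epsilon>. (1 - c_coeff M \<epsilon> h k 0) / complex_of_real (\<epsilon>\<^sup>2)) \<longlongrightarrow>
           complex_of_real (diffusion_coeff M k) + 1 / complex_of_real h) (at_right 0)"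
    and "((\<lambda>\<epsilon>. b_coeff M \<epsilon> h k 0 / complex_of_real (\<epsilon>\<^sup>2)) \<longlongrightarrow> 1 / complex_of_real h) (at_right 0)"
proof -
  define R where "R \<epsilon> = bracket (\<lambda>v. 1 / symb \<epsilon> k v * complex_of_real ((k \<bullet> v)\<^sup>2 * M v))" for \<epsilon>
  define Q where "Q \<epsilon> = bracket (\<lambda>v. (1 - decay \<epsilon> k h v) / (symb \<epsilon> k v)\<^sup>2 * complex_of_real (M v))" for \<epsilon>
  define P where "P \<epsilon> = bracket (\<lambda>v. decay \<epsilon> k h v / symb \<epsilon> k v * complex_of_real (M v))" for \<epsilon>
  note E = leading_coefficients_expansion[OF M _ h, where k=k, folded R_def Q_def P_def]
  have "(R \<longlongrightarrow> bracket (\<lambda>v. 1 * complex_of_real ((k \<bullet> v)\<^sup>2 * M v))) (at_right 0)"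
    unfolding R_def
  proof (rule bracket_tendsto_at_right)
    show "integrable lborel (\<lambda>v. complex_of_real ((k \<bullet> v)\<^sup>2 * M v))"
      by (rule integrable_of_real[OF equilibrium_moments(3)[OF M]])
    show "(\<lambda>v. 1 / symb \<epsilon> k v) \<in> borel_measurable borel" for \<epsilon>
      by (rule measurable_symb_quotients)
    show "norm (1 / symb \<epsilon> k v) \<le> 1" for \<epsilon> v
      by (rule norm_symb_quotients_le)
    show "((\<lambda>\<epsilon>. 1 / symb \<epsilon> k v) \<longlongrightarrow> 1) (at_right 0)" for v
      using tendsto_divide[OF tendsto_const[of 1] symb_tendsto_1[of k v]] by simp
  qed simp
  then have R: "(R \<longlongrightarrow> complex_of_real (diffusion_coeff M k)) (at_right 0)"
    by (simp add: diffusion_coeff_def del: of_real_mult)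
  have "(Q \<longlongrightarrow> bracket (\<lambda>v. 1 * complex_of_real (M v))) (at_right 0)"
    unfolding Q_def
  proof (rule bracket_tendsto_at_right)
    show "integrable lborel (\<lambda>v. complex_of_real (M v))"
      by (rule diffusive_equilibriumD(5)[OF M])
    show "(\<lambda>v. (1 - decay \<epsilon> k h v) / (symb \<epsilon> k v)\<^sup>2) \<in> borel_measurable borel" for \<epsilon>
      by (rule measurable_symb_quotients)
    show "norm ((1 - decay \<epsilon> k h v) / (symb \<epsilon> k v)\<^sup>2) \<le> 2" for \<epsilon> v
      using h by (intro norm_symb_quotients_le) simp
    show "((\<lambda>\<epsilon>. (1 - decay \<epsilon> k h v) / (symb \<epsilon> k v)\<^sup>2) \<longlongrightarrow> 1) (at_right 0)" for v
    proof -
      have "((\<lambda>\<epsilon>. (1 - decay \<epsilon> k h v) / (symb \<epsilon> k v)\<^sup>2) \<longlongrightarrow> (1 - 0) / 1\<^sup>2) (at_right 0)"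
        by (intro tendsto_intros decay_tendsto_0[OF h] symb_tendsto_1) simp
      then show ?thesis by simp
    qed
  qed simp
  then have Q: "(Q \<longlongrightarrow> 1) (at_right 0)"
    using diffusive_equilibriumD(6)[OF M] by simp
  have P: "((\<lambda>\<epsilon>. P \<epsilon> / complex_of_real (\<epsilon>\<^sup>2)) \<longlongrightarrow> 0) (at_right 0)"
  proof (rule Lim_null_comparison[OF _ relax_over_square_tendsto_0[OF h]])
    show "\<forall>\<^sub>F \<epsilon> in at_right 0. norm (P \<epsilon> / complex_of_real (\<epsilon>\<^sup>2)) \<le> relax \<epsilon> h / \<epsilon>\<^sup>2"
      using eventually_at_right_less[of 0]
      by eventually_elim (simp add: norm_divide norm_power divide_right_mono E(3))
  qed
  have "((\<lambda>\<epsilon>. R \<epsilon> + Q \<epsilon> / complex_of_real h) \<longlongrightarrow> complex_of_real (diffusion_coeff M k) + 1 / complex_of_real h) (at_right 0)"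
    by (intro tendsto_intros R Q) (use h in simp)
  then show "((\<lambda>\<epsilon>. (1 - c_coeff M \<epsilon> h k 0) / complex_of_real (\<epsilon>\<^sup>2)) \<longlongrightarrow>
           complex_of_real (diffusion_coeff M k) + 1 / complex_of_real h) (at_right 0)"
    by (rule Lim_transform_eventually)
      (use eventually_at_right_less[of 0] in eventually_elim, simp only: E(1))
  have "((\<lambda>\<epsilon>. Q \<epsilon> / complex_of_real h - P \<epsilon> / complex_of_real (\<epsilon>\<^sup>2)) \<longlongrightarrow> 1 / complex_of_real h - 0) (at_right 0)"
    by (intro tendsto_diff tendsto_divide Q P tendsto_const) (use h in simp)
  then have "((\<lambda>\<epsilon>. b_coeff M \<epsilon> h k 0 / complex_of_real (\<epsilon>\<^sup>2)) \<longlongrightarrow> 1 / complex_of_real h - 0) (at_right 0)"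
    by (rule Lim_transform_eventually)
      (use eventually_at_right_less[of 0] in eventually_elim, simp only: E(2))
  then show "((\<lambda>\<epsilon>. b_coeff M \<epsilon> h k 0 / complex_of_real (\<epsilon>\<^sup>2)) \<longlongrightarrow> 1 / complex_of_real h) (at_right 0)"
    by simp
qed

text \<open>The memory of the kernel is of length \<open>\<epsilon>\<^sup>2\<close>, much shorter than the time step.\<close>

lemma memory_coefficients_tendsto_0:
  assumes M: "diffusive_equilibrium M" and h: "0 < h" and j: "1 \<le> j"
  shows "((\<lambda>\<epsilon>. c_coeff M \<epsilon> h k j / complex_of_real (\<epsilon>\<^sup>2)) \<longlongrightarrow> 0) (at_right 0)"
    and "((\<lambda>\<epsilon>. b_coeff M \<epsilon> h k j / complex_of_real (\<epsilon>\<^sup>2)) \<longlongrightarrow> 0) (at_right 0)"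
proof -
  have jh: "0 < real j * h" using j h by simp
  have maj: "c_majorant \<epsilon> h j \<le> relax \<epsilon> (real j * h)" "b_majorant \<epsilon> h j \<le> relax \<epsilon> (real j * h)"
    if "0 < \<epsilon>" for \<epsilon>
  proof -
    have "c_majorant \<epsilon> h j + b_majorant \<epsilon> h j = relax \<epsilon> (real j * h) - relax \<epsilon> (real (j + 1) * h)"
      by (simp add: c_majorant_def b_majorant_def)
    then show "c_majorant \<epsilon> h j \<le> relax \<epsilon> (real j * h)" "b_majorant \<epsilon> h j \<le> relax \<epsilon> (real j * h)"
      using majorant_nonneg[of \<epsilon> h j] that h relax_pos[of \<epsilon> "real (j + 1) * h"] by auto
  qed
  have "\<forall>\<^sub>F \<epsilon> in at_right 0. norm (c_coeff M \<epsilon> h k j / complex_of_real (\<epsilon>\<^sup>2)) \<le> relax \<epsilon> (real j * h) / \<epsilon>\<^sup>2"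
    using eventually_at_right_less[of 0]
  proof eventually_elim
    case (elim \<epsilon>)
    then have "norm (c_coeff M \<epsilon> h k j) \<le> relax \<epsilon> (real j * h)"
      using c_coeff_bounds(1)[OF M _ h, of \<epsilon> k j] maj(1)[of \<epsilon>] by auto
    then show ?case by (simp add: norm_divide norm_power divide_right_mono)
  qed
  then show "((\<lambda>\<epsilon>. c_coeff M \<epsilon> h k j / complex_of_real (\<epsilon>\<^sup>2)) \<longlongrightarrow> 0) (at_right 0)"
    by (rule Lim_null_comparison[OF _ relax_over_square_tendsto_0[OF jh]])
  have "\<forall>\<^sub>F \<epsilon> in at_right 0. norm (b_coeff M \<epsilon> h k j / complex_of_real (\<epsilon>\<^sup>2)) \<le> relax \<epsilon> (real j * h) / \<epsilon>\<^sup>2"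
    using eventually_at_right_less[of 0]
  proof eventually_elim
    case (elim \<epsilon>)
    then have "norm (b_coeff M \<epsilon> h k j) \<le> relax \<epsilon> (real j * h)"
      using b_coeff_bounds(1)[OF M _ h, of \<epsilon> k j] maj(2)[of \<epsilon>] by auto
    then show ?case by (simp add: norm_divide norm_power divide_right_mono)
  qed
  then show "((\<lambda>\<epsilon>. b_coeff M \<epsilon> h k j / complex_of_real (\<epsilon>\<^sup>2)) \<longlongrightarrow> 0) (at_right 0)"
    by (rule Lim_null_comparison[OF _ relax_over_square_tendsto_0[OF jh]])
qed

lemma initial_layer_tendsto_0:
  assumes f0: "phase_integrable a b f0" and t: "0 < t"
  shows "((\<lambda>\<epsilon>. A0_hat a b f0 \<epsilon> t k / complex_of_real (\<epsilon>\<^sup>2)) \<longlongrightarrow> 0) (at_right 0)"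
proof (rule Lim_null_comparison)
  define C where "C = bracket (\<lambda>v. norm (f0_hat a b f0 k v))"
  have int: "integrable lborel (f0_hat a b f0 k)"
    unfolding f0_hat_def[abs_def] by (rule fourier_integrate_out(1)[OF f0])
  have "norm (A0_hat a b f0 \<epsilon> t k) \<le> relax \<epsilon> t * C" for \<epsilon>
  proof -
    have "norm (A0_hat a b f0 \<epsilon> t k) \<le> bracket (\<lambda>v. relax \<epsilon> t * norm (f0_hat a b f0 k v))"
      unfolding A0_hat_def
      by (rule Bochner_Integration.integral_norm_bound_integral
          [OF integrable_bounded_mult[OF int _ eq_refl[OF norm_decay]]])
        (use int measurable_decay in \<open>auto simp: norm_mult norm_decay\<close>)
    then show ?thesis by (simp add: C_def)
  qed
  then show "\<forall>\<^sub>F \<epsilon> in at_right 0. norm (A0_hat a b f0 \<epsilon> t k / complex_of_real (\<epsilon>\<^sup>2)) \<le> relax \<epsilon> t / \<epsilon>\<^sup>2 * C"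
    by (intro always_eventually allI) (simp add: norm_divide norm_power divide_right_mono)
  show "((\<lambda>\<epsilon>. relax \<epsilon> t / \<epsilon>\<^sup>2 * C) \<longlongrightarrow> 0) (at_right 0)"
    using tendsto_mult[OF relax_over_square_tendsto_0[OF t] tendsto_const[of C]] by simp
qed

text \<open>Numerator and denominator of the scheme are both of order \<open>\<epsilon>\<^sup>2\<close>; after division by \<open>\<epsilon>\<^sup>2\<close> both
converge, and only \<open>b\<^sub>0 \<rho>\<^sup>n\<close> survives in the numerator.\<close>

lemma scheme_diffusion_limit:
  assumes M: "diffusive_equilibrium M" and f0: "phase_integrable a b f0" and h: "0 < h"
  shows "((\<lambda>\<epsilon>. scheme M a b f0 \<epsilon> h k n) \<longlongrightarrow>
          rho0_hat a b f0 k / (1 + complex_of_real (diffusion_coeff M k * h)) ^ n) (at_right 0)"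
proof (induction n rule: less_induct)
  case (less n)
  define D where "D = complex_of_real (diffusion_coeff M k)"
  define L where "L i = rho0_hat a b f0 k / (1 + complex_of_real (diffusion_coeff M k * h)) ^ i" for i
  have IH: "((\<lambda>\<epsilon>. scheme M a b f0 \<epsilon> h k i) \<longlongrightarrow> L i) (at_right 0)" if "i < n" for i
    using less[OF that] by (simp add: L_def)
  have "0 < 1 + diffusion_coeff M k * h"
    using diffusion_coeff_nonneg[OF M, of k] h by (simp add: add_pos_nonneg)
  then have den: "1 + D * complex_of_real h \<noteq> 0"
    unfolding D_def by (metis of_real_1 of_real_add of_real_eq_0_iff of_real_mult less_irrefl)
  show ?case
  proof (cases n)
    case 0
    then show ?thesis by simp
  next
    case (Suc m)
    define e2 :: "real \<Rightarrow> complex" where "e2 \<epsilon> = complex_of_real (\<epsilon>\<^sup>2)" for \<epsilon>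
    let ?S = "\<lambda>\<epsilon>. scheme M a b f0 \<epsilon> h k" and ?c = "\<lambda>\<epsilon>. c_coeff M \<epsilon> h k" and ?b = "\<lambda>\<epsilon>. b_coeff M \<epsilon> h k"
    \<comment> \<open>The recursion of the scheme with numerator and denominator divided by \<open>\<epsilon>\<^sup>2\<close>.\<close>
    define F where "F \<epsilon> = (A0_hat a b f0 \<epsilon> (real (m + 1) * h) k / e2 \<epsilon>
        + (\<Sum>j = 1..m. ?c \<epsilon> j / e2 \<epsilon> * ?S \<epsilon> (m + 1 - j) + ?b \<epsilon> j / e2 \<epsilon> * ?S \<epsilon> (m - j))
        + ?b \<epsilon> 0 / e2 \<epsilon> * ?S \<epsilon> m) / ((1 - ?c \<epsilon> 0) / e2 \<epsilon>)" for \<epsilon>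
    have F: "F \<epsilon> = ?S \<epsilon> (Suc m)" if "0 < \<epsilon>" for \<epsilon>
    proof -
      have e2: "e2 \<epsilon> \<noteq> 0" using that by (simp add: e2_def)
      have factor: "(A0_hat a b f0 \<epsilon> (real (m + 1) * h) k / e2 \<epsilon>
        + (\<Sum>j = 1..m. ?c \<epsilon> j / e2 \<epsilon> * ?S \<epsilon> (m + 1 - j) + ?b \<epsilon> j / e2 \<epsilon> * ?S \<epsilon> (m - j))
        + ?b \<epsilon> 0 / e2 \<epsilon> * ?S \<epsilon> m)
        = (A0_hat a b f0 \<epsilon> (real (m + 1) * h) k
        + (\<Sum>j = 1..m. ?c \<epsilon> j * ?S \<epsilon> (m + 1 - j) + ?b \<epsilon> j * ?S \<epsilon> (m - j))
        + ?b \<epsilon> 0 * ?S \<epsilon> m) / e2 \<epsilon>"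
        by (simp only: add_divide_distrib sum_divide_distrib times_divide_eq_left)
      have cancel: "x / e2 \<epsilon> / (y / e2 \<epsilon>) = x / y" for x y
        using e2 by simp
      show ?thesis
        unfolding F_def scheme.simps(2) factor by (rule cancel)
    qed
    have pos: "0 < real (m + 1) * h" using h by simp
    have lim: "(F \<longlongrightarrow> (0 + (\<Sum>j = 1..m. 0 * L (m + 1 - j) + 0 * L (m - j)) + 1 / complex_of_real h * L m)
        / (D + 1 / complex_of_real h)) (at_right 0)"
      unfolding F_def e2_def D_def
    proof (rule tendsto_divide[OF tendsto_add[OF tendsto_add[OF initial_layer_tendsto_0[OF f0 pos] tendsto_sum]
            tendsto_mult[OF leading_coefficients_tendsto(2)[OF M h]]] leading_coefficients_tendsto(1)[OF M h]])
      show "((\<lambda>\<epsilon>. ?c \<epsilon> j / complex_of_real (\<epsilon>\<^sup>2) * ?S \<epsilon> (m + 1 - j)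
          + ?b \<epsilon> j / complex_of_real (\<epsilon>\<^sup>2) * ?S \<epsilon> (m - j)) \<longlongrightarrow> 0 * L (m + 1 - j) + 0 * L (m - j)) (at_right 0)"
        if "j \<in> {1..m}" for j
        by (rule tendsto_add[OF tendsto_mult[OF memory_coefficients_tendsto_0(1)[OF M h] IH]
              tendsto_mult[OF memory_coefficients_tendsto_0(2)[OF M h] IH]]) (use that Suc in auto)
      show "((\<lambda>\<epsilon>. ?S \<epsilon> m) \<longlongrightarrow> L m) (at_right 0)"
        using IH Suc by simp
      show "complex_of_real (diffusion_coeff M k) + 1 / complex_of_real h \<noteq> 0"
        using den h by (simp add: D_def field_simps)
    qed
    have "(0 + (\<Sum>j = 1..m. 0 * L (m + 1 - j) + 0 * L (m - j)) + 1 / complex_of_real h * L m)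
        / (D + 1 / complex_of_real h) = L (Suc m)"
    proof -
      have "1 / complex_of_real h / (D + 1 / complex_of_real h) = 1 / (1 + D * complex_of_real h)"
        using h den by (simp add: field_simps)
      then have "1 / complex_of_real h * L m / (D + 1 / complex_of_real h) = L m / (1 + D * complex_of_real h)"
        by (metis times_divide_eq_left mult_1)
      then show ?thesis
        by (simp add: L_def D_def mult.commute)
    qed
    with lim have "(F \<longlongrightarrow> L (Suc m)) (at_right 0)" by simp
    then have "((\<lambda>\<epsilon>. ?S \<epsilon> (Suc m)) \<longlongrightarrow> L (Suc m)) (at_right 0)"
      by (rule Lim_transform_eventually)
        (use eventually_at_right_less[of 0] in eventually_elim, simp only: F)
    then show ?thesis by (simp only: Suc L_def)
  qed
qed

section \<open>Convergence of the limit scheme and the theorem\<close>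

lemma diffusion_solution_exp:
  assumes u: "diffusion_solution M T k u0 u" and t: "t \<in> {0..T}"
  shows "u t = u0 * complex_of_real (exp (- diffusion_coeff M k * t))"
proof -
  let ?D = "diffusion_coeff M k"
  have u': "(u has_vector_derivative - complex_of_real ?D * u s) (at s within {0..T})" if "s \<in> {0..T}" for s
    using u that by (simp add: diffusion_solution_def)
  obtain c where c: "\<And>s. s \<in> {0..T} \<Longrightarrow> complex_of_real (exp (?D * s)) * u s = c"
  proof (rule has_vector_derivative_zero_constant[of "{0..T}" "\<lambda>s. complex_of_real (exp (?D * s)) * u s"])
    show "convex {0..T}" by simp
    fix s assume s: "s \<in> {0..T}"
    have "((\<lambda>s. exp (?D * s)) has_real_derivative ?D * exp (?D * s)) (at s within {0..T})"
      by (auto intro!: derivative_eq_intros)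
    then have "((\<lambda>s. complex_of_real (exp (?D * s))) has_vector_derivative complex_of_real (?D * exp (?D * s))) (at s within {0..T})"
      by (rule has_vector_derivative_of_real)
    from has_vector_derivative_mult[OF this u'[OF s]]
    show "((\<lambda>s. complex_of_real (exp (?D * s)) * u s) has_vector_derivative 0) (at s within {0..T})"
      by (simp add: algebra_simps)
  qed blast
  have "complex_of_real (exp (?D * t)) * u t = complex_of_real (exp (?D * 0)) * u 0"
    using c[OF t] c[of 0] t by simp
  then have "complex_of_real (exp (?D * t)) * u t = u0"
    using u by (simp add: diffusion_solution_def)
  then show ?thesis
    by (simp add: exp_minus of_real_inverse field_simps)
qed

lemma exp_implicit_euler_step:
  fixes x :: real
  assumes "0 \<le> x"
  shows "\<bar>1 / (1 + x) - exp (- x)\<bar> \<le> x\<^sup>2"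
proof -
  have 1: "exp (- x) \<le> 1 / (1 + x)"
    using exp_ge_add_one_self[of x] assms by (simp add: exp_minus field_simps)
  have 2: "1 - x \<le> exp (- x)"
    using exp_ge_add_one_self[of "- x"] by simp
  have "1 / (1 + x) - (1 - x) = x\<^sup>2 / (1 + x)"
    using assms by (simp add: field_simps power2_eq_square)
  also have "\<dots> \<le> x\<^sup>2"
    using assms by (simp add: field_simps)
  finally show ?thesis using 1 2 by simp
qed

text \<open>Both \<open>1 / (1 + x)\<close> and \<open>exp (- x)\<close> lie in the unit interval, so the local errors \<open>x\<^sup>2\<close> add up without
amplification; with \<open>x = D T / N\<close> the total is of order \<open>1 / N\<close>.\<close>

lemma implicit_euler_grid_convergent:
  assumes D: "0 \<le> diffusion_coeff M k" and T: "0 < T"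
    and u: "diffusion_solution M T k u0 u"
  shows "grid_convergent T (\<lambda>N n. u0 / (1 + complex_of_real (diffusion_coeff M k * (T / real N))) ^ n) u"
  unfolding grid_convergent_def
proof (intro allI impI)
  fix e :: real assume e: "0 < e"
  let ?D = "diffusion_coeff M k"
  have "(\<lambda>N. norm u0 * (?D * T)\<^sup>2 / real N) \<longlonglongrightarrow> 0"
    by (rule lim_const_over_n)
  then have "\<forall>\<^sub>F N in sequentially. norm u0 * (?D * T)\<^sup>2 / real N < e"
    using e by (rule order_tendstoD)
  then show "\<forall>\<^sub>F N in sequentially. \<forall>n\<le>N.
      norm (u0 / (1 + complex_of_real (?D * (T / real N))) ^ n - u (real n * (T / real N))) < e"
    using eventually_gt_at_top[of 0]
  proof eventually_elim
    case (elim N)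
    define x where "x = ?D * (T / real N)"
    have x: "0 \<le> x" using D T by (simp add: x_def)
    show ?case
    proof (intro allI impI)
      fix n assume n: "n \<le> N"
      have "real n * (T / real N) \<le> T"
        using n T elim by (simp add: field_simps)
      then have "u (real n * (T / real N)) = u0 * complex_of_real (exp (- ?D * (real n * (T / real N))))"
        using T by (intro diffusion_solution_exp[OF u]) simp
      also have "exp (- ?D * (real n * (T / real N))) = exp (- x) ^ n"
        by (simp add: x_def exp_of_nat_mult[symmetric] algebra_simps)
      finally have "u0 / (1 + complex_of_real x) ^ n - u (real n * (T / real N))
          = u0 * complex_of_real ((1 / (1 + x)) ^ n - exp (- x) ^ n)"
        by (simp only: of_real_diff right_diff_distrib) (simp add: power_divide)
      then have "norm (u0 / (1 + complex_of_real x) ^ n - u (real n * (T / real N)))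
          = norm (u0 * complex_of_real ((1 / (1 + x)) ^ n - exp (- x) ^ n))"
        by (simp only:)
      also have "\<dots> = norm u0 * \<bar>(1 / (1 + x)) ^ n - exp (- x) ^ n\<bar>"
        by (simp only: norm_mult norm_of_real)
      also have "\<dots> \<le> norm u0 * (real n * x\<^sup>2)"
      proof (intro mult_left_mono)
        have "norm ((1 / (1 + x)) ^ n - exp (- x) ^ n) \<le> real n * norm (1 / (1 + x) - exp (- x))"
          using x by (intro norm_power_diff) auto
        also have "\<dots> \<le> real n * x\<^sup>2"
          using exp_implicit_euler_step[OF x] by (intro mult_left_mono) auto
        finally show "\<bar>(1 / (1 + x)) ^ n - exp (- x) ^ n\<bar> \<le> real n * x\<^sup>2" by simp
      qed simp
      also have "\<dots> \<le> norm u0 * (real N * x\<^sup>2)"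
        using n by (intro mult_left_mono mult_right_mono) auto
      also have "\<dots> = norm u0 * (?D * T)\<^sup>2 / real N"
        using elim by (simp add: x_def field_simps power2_eq_square)
      also have "\<dots> < e" by (rule elim)
      finally show "norm (u0 / (1 + complex_of_real (?D * (T / real N))) ^ n - u (real n * (T / real N))) < e"
        by (simp only: x_def)
    qed
  qed
qed

lemma implicit_euler_step:
  assumes D: "0 \<le> D" and h: "0 < h"
  shows "(u0 / (1 + complex_of_real (D * h)) ^ (n + 1) - u0 / (1 + complex_of_real (D * h)) ^ n) / complex_of_real h
       = - complex_of_real D * (u0 / (1 + complex_of_real (D * h)) ^ (n + 1))"
proof -
  define z where "z = 1 + complex_of_real (D * h)"
  have "0 < 1 + D * h" using D h by (simp add: add_pos_nonneg)
  then have z: "z \<noteq> 0" "complex_of_real D * complex_of_real h = z - 1"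
    unfolding z_def by (metis of_real_1 of_real_add of_real_eq_0_iff less_irrefl, simp)
  have "u0 / z ^ (n + 1) - u0 / z ^ n = - (complex_of_real D * complex_of_real h) * (u0 / z ^ (n + 1))"
    unfolding z(2) using z(1) by (simp add: field_simps)
  then show ?thesis
    using h unfolding z_def[symmetric] by (simp add: field_simps)
qed

lemma scheme_asymptotic_preserving:
  assumes M: "diffusive_equilibrium M" and box: "\<And>i. a $ i < b $ i" and T: "0 < T"
  shows "asymptotic_preserving M a b T (scheme M a b)"
  unfolding asymptotic_preserving_def
proof (intro allI ballI impI conjI)
  fix f0 k assume f0: "phase_integrable a b f0" and k: "k \<in> frequencies a b"
  show "grid_convergent T (\<lambda>N. scheme M a b f0 \<epsilon> (T / real N) k) (rho_hat a b f k)"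
    if "0 < \<epsilon>" "kinetic_solution M a b T \<epsilon> f0 f" for \<epsilon> f
    by (rule scheme_grid_convergent[OF M box T that(1) k that(2)])
  show "\<exists>L. (\<forall>N\<ge>1. \<forall>n\<le>N. ((\<lambda>\<epsilon>. scheme M a b f0 \<epsilon> (T / real N) k n) \<longlongrightarrow> L N n) (at_right 0)) \<and>
      (\<forall>u. diffusion_solution M T k (rho0_hat a b f0 k) u \<longrightarrow> grid_convergent T L u)"
  proof (intro exI conjI allI impI)
    fix N n :: nat assume "1 \<le> N"
    then have "0 < T / real N" using T by simp
    then show "((\<lambda>\<epsilon>. scheme M a b f0 \<epsilon> (T / real N) k n) \<longlongrightarrow>
        rho0_hat a b f0 k / (1 + complex_of_real (diffusion_coeff M k * (T / real N))) ^ n) (at_right 0)"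
      by (rule scheme_diffusion_limit[OF M f0])
  qed (rule implicit_euler_grid_convergent[OF diffusion_coeff_nonneg[OF M] T])
qed

theorem proposition3p5:
  fixes M :: "real^'d \<Rightarrow> real" and a b :: "real^'d" and T :: real
  assumes dim: "CARD('d) \<in> {1, 2, 3}"
    and equilibrium: "diffusive_equilibrium M"
    and box: "\<And>i. a $ i < b $ i"
    and T: "0 < T"
  shows
    "((\<forall>K. \<exists>C. \<forall>\<epsilon>>0. \<forall>f0 f. \<forall>k\<in>frequencies a b.
         kinetic_solution M a b T \<epsilon> f0 f \<longrightarrow> time_derivatives_bounded T K (rho_hat a b f k) \<longrightarrow>
         (\<forall>N dt. real N * dt = T \<longrightarrow> (\<forall>n\<le>N.
            norm (scheme M a b f0 \<epsilon> dt k n - rho_hat a b f k (real n * dt)) \<le> C * dt)))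
      \<and> (\<forall>\<epsilon>>0. \<forall>f0. phase_integrable a b f0 \<longrightarrow>
         (\<forall>N dt. real N * dt = T \<longrightarrow> (\<forall>n\<in>{1..N}.
            scheme M a b f0 \<epsilon> dt 0 n = scheme M a b f0 \<epsilon> dt 0 0))))
     \<and> (asymptotic_preserving M a b T (scheme M a b)
      \<and> (\<forall>f0. phase_integrable a b f0 \<longrightarrow> (\<forall>k\<in>frequencies a b. \<forall>N dt. real N * dt = T \<longrightarrow>
         (\<exists>r. r 0 = rho0_hat a b f0 k \<and>
              (\<forall>n\<le>N. ((\<lambda>\<epsilon>. scheme M a b f0 \<epsilon> dt k n) \<longlongrightarrow> r n) (at_right 0)) \<and>
              (\<forall>n<N. (r (n + 1) - r n) / complex_of_real dt
                       = - complex_of_real (diffusion_coeff M k) * r (n + 1))))))"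
proof (intro conjI)
  note M = equilibrium
  have step: "0 < dt" if "real N * dt = T" for N :: nat and dt :: real
    using T that by (metis mult_nonneg_nonpos not_less of_nat_0_le_iff)
  show "\<forall>K. \<exists>C. \<forall>\<epsilon>>0. \<forall>f0 f. \<forall>k\<in>frequencies a b.
         kinetic_solution M a b T \<epsilon> f0 f \<longrightarrow> time_derivatives_bounded T K (rho_hat a b f k) \<longrightarrow>
         (\<forall>N dt. real N * dt = T \<longrightarrow> (\<forall>n\<le>N.
            norm (scheme M a b f0 \<epsilon> dt k n - rho_hat a b f k (real n * dt)) \<le> C * dt))"
  proof
    fix K
    show "\<exists>C. \<forall>\<epsilon>>0. \<forall>f0 f. \<forall>k\<in>frequencies a b.
         kinetic_solution M a b T \<epsilon> f0 f \<longrightarrow> time_derivatives_bounded T K (rho_hat a b f k) \<longrightarrow>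
         (\<forall>N dt. real N * dt = T \<longrightarrow> (\<forall>n\<le>N.
            norm (scheme M a b f0 \<epsilon> dt k n - rho_hat a b f k (real n * dt)) \<le> C * dt))"
      by (rule exI[of _ "K * T"]) (intro allI ballI impI scheme_first_order[OF M box T])
  qed
  show "\<forall>\<epsilon>>0. \<forall>f0. phase_integrable a b f0 \<longrightarrow>
         (\<forall>N dt. real N * dt = T \<longrightarrow> (\<forall>n\<in>{1..N}.
            scheme M a b f0 \<epsilon> dt 0 n = scheme M a b f0 \<epsilon> dt 0 0))"
  proof (intro allI impI ballI)
    fix \<epsilon> dt :: real and f0 and N n :: nat
    assume "0 < \<epsilon>" "real N * dt = T"
    then show "scheme M a b f0 \<epsilon> dt 0 n = scheme M a b f0 \<epsilon> dt 0 0"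
      by (intro scheme_mass_conservation[OF M] step) auto
  qed
  show "asymptotic_preserving M a b T (scheme M a b)"
    by (rule scheme_asymptotic_preserving[OF M box T])
  show "\<forall>f0. phase_integrable a b f0 \<longrightarrow> (\<forall>k\<in>frequencies a b. \<forall>N dt. real N * dt = T \<longrightarrow>
         (\<exists>r. r 0 = rho0_hat a b f0 k \<and>
              (\<forall>n\<le>N. ((\<lambda>\<epsilon>. scheme M a b f0 \<epsilon> dt k n) \<longlongrightarrow> r n) (at_right 0)) \<and>
              (\<forall>n<N. (r (n + 1) - r n) / complex_of_real dt
                       = - complex_of_real (diffusion_coeff M k) * r (n + 1))))"
  proof (intro allI impI ballI)
    fix f0 k and N :: nat and dt :: real
    assume f0: "phase_integrable a b f0" and dt: "real N * dt = T"
    let ?r = "\<lambda>n. rho0_hat a b f0 k / (1 + complex_of_real (diffusion_coeff M k * dt)) ^ n"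
    show "\<exists>r. r 0 = rho0_hat a b f0 k \<and>
              (\<forall>n\<le>N. ((\<lambda>\<epsilon>. scheme M a b f0 \<epsilon> dt k n) \<longlongrightarrow> r n) (at_right 0)) \<and>
              (\<forall>n<N. (r (n + 1) - r n) / complex_of_real dt
                       = - complex_of_real (diffusion_coeff M k) * r (n + 1))"
    proof (rule exI[of _ ?r], intro conjI allI impI)
      show "?r 0 = rho0_hat a b f0 k" by simp
      show "((\<lambda>\<epsilon>. scheme M a b f0 \<epsilon> dt k n) \<longlongrightarrow> ?r n) (at_right 0)" for n
        by (rule scheme_diffusion_limit[OF M f0 step[OF dt]])
      show "(?r (n + 1) - ?r n) / complex_of_real dt = - complex_of_real (diffusion_coeff M k) * ?r (n + 1)" for n
        by (rule implicit_euler_step[OF diffusion_coeff_nonneg[OF M] step[OF dt]])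
    qed
  qed
qed

end
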